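(* Consider four anyons of topological charges $2,2,1,1$ (in this order, with total charge $0$) in the Kauffman–Jones version of $SU(2)$ Chern–Simons theory at level $4$, with the associated two-dimensional state space having orthonormal basis $|0\rangle,|2\rangle$. Then a full twist $\sigma_2^2$ of the second and third anyons (which have charges $2$ and $1$) has the effect of swapping $|0\rangle$ and $|2\rangle$: it sends $|0\rangle$ to a unit complex multiple of $|2\rangle$ and $|2\rangle$ to a unit complex multiple of $|0\rangle$.
   Context: The Kauffman–Jones version of $SU(2)$ Chern–Simons theory at level $4$ is the unitary Temperley–Lieb–Jones theory (Kauffman–Lins recoupling theory) at the Kauffman variable $A=i e^{-i\pi/12}$ (loop value $-A^2-A^{-2}=\sqrt3$). Its simple objects (topological charges) are $0,1,2,3,4$. A triple $(a,b,c)$ is admissible (multiplicity one) iff $a+b+c$ is even, $a\le b+c$, $b\le a+c$, $c\le a+b$ and $a+b+c\le 8$; charge $0$ is the vacuum. For four anyons of charges $a_1,a_2,a_3,a_4$ with total charge $0$, the vector $|c\rangle$ denotes the normalized fusion tree in which the first two anyons fuse to $c$, the last two anyons fuse to $c$, and these two charges fuse to $0$. For charges $2,2,1,1$ the possible values are $c\in\{0,2\}$. The full twist $\sigma_2^2$ is the double braiding of the second and third anyons, i.e. one of them goes once completely around the other. *)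

theory Defs
  imports Complex_Main "HOL-Library.Poly_Mapping" "HOL-Library.Disjoint_Sets"
begin

section \<open>The Kauffman variable\<close>

definition kauffman_A :: complex where
  "kauffman_A = \<i> * exp (- (\<i> * of_real (pi / 12)))"

definition loop_value :: complex where
  "loop_value = - (kauffman_A ^ 2) - inverse (kauffman_A ^ 2)"

section \<open>Temperley-Lieb diagrams\<close>

text \<open>
  A diagram from m to n points is a triple (m, n, E). The boundary points are (0, i) for i < m
  (bottom) and (1, j) for j < n (top), numbered from left to right; E is the set of arcs, each arc
  being the set of its two end points. Isotopic diagrams are thus equal.
\<close>

type_synonym point = "nat \<times> nat"
type_synonym diagram = "nat \<times> nat \<times> point set set"

definition boundary_points :: "nat \<Rightarrow> nat \<Rightarrow> point set" where
  "boundary_points m n = {0} \<times> {..<m} \<union> {1} \<times> {..<n}"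

text \<open>Position of a point when the boundary of the rectangle is traversed once.\<close>

definition circ_pos :: "nat \<Rightarrow> nat \<Rightarrow> point \<Rightarrow> nat" where
  "circ_pos m n = (\<lambda>(l, i). if l = 0 then i else m + n - 1 - i)"

definition noncrossing :: "nat \<Rightarrow> nat \<Rightarrow> point set set \<Rightarrow> bool" where
  "noncrossing m n E \<longleftrightarrow>
     \<not> (\<exists>x y x' y'. {x, y} \<in> E \<and> {x', y'} \<in> E \<and>
          circ_pos m n x < circ_pos m n x' \<and> circ_pos m n x' < circ_pos m n y \<and>
          circ_pos m n y < circ_pos m n y')"

definition planar_diagrams :: "nat \<Rightarrow> nat \<Rightarrow> diagram set" where
  "planar_diagrams m n =
     {(m, n, E) | E. partition_on (boundary_points m n) E \<and> (\<forall>B\<in>E. card B = 2) \<and>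
                     noncrossing m n E}"

text \<open>
  Stacking the diagram F on top of E: F is raised by one level, so that the points glued together
  are those of level 1. A connected component disjoint from the levels 0 and 2 is a closed loop.
\<close>

definition glue :: "point set set \<Rightarrow> point set set \<Rightarrow> point set set" where
  "glue F E = E \<union> (`) (\<lambda>(l, i). (Suc l, i)) ` F"

definition components :: "point set set \<Rightarrow> point set set" where
  "components G = \<Union>G // {(x, y). \<exists>B\<in>G. x \<in> B \<and> y \<in> B}\<^sup>*"

definition outer_points :: "point set \<Rightarrow> point set" where
  "outer_points C = {(if l = 0 then 0 else 1, i) | l i. (l, i) \<in> C \<and> l \<noteq> 1}"

definition diagram_comp :: "diagram \<Rightarrow> diagram \<Rightarrow> diagram" where
  "diagram_comp = (\<lambda>(_, k, F) (m, _, E). (m, k, outer_points ` components (glue F E) - {{}}))"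

definition diagram_loops :: "diagram \<Rightarrow> diagram \<Rightarrow> nat" where
  "diagram_loops = (\<lambda>(_, _, F) (_, _, E). card {C \<in> components (glue F E). outer_points C = {}})"

text \<open>Juxtaposition, the first diagram being on the left.\<close>

definition diagram_tensor :: "diagram \<Rightarrow> diagram \<Rightarrow> diagram" where
  "diagram_tensor = (\<lambda>(m, n, E) (m', n', F).
     (m + m', n + n', E \<union> (`) (\<lambda>(l, i). (l, (if l = 0 then m else n) + i)) ` F))"

definition diagram_reflect :: "diagram \<Rightarrow> diagram" where
  "diagram_reflect = (\<lambda>(m, n, E). (n, m, (`) (\<lambda>(l, i). (1 - l, i)) ` E))"

section \<open>The Temperley-Lieb category\<close>

type_synonym tl = "diagram \<Rightarrow>\<^sub>0 complex"

definition tl_hom :: "nat \<Rightarrow> nat \<Rightarrow> tl set" where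
  "tl_hom m n = {f. Poly_Mapping.keys f \<subseteq> planar_diagrams m n}"

definition tl_scale :: "complex \<Rightarrow> tl \<Rightarrow> tl"  (infixr "*\<^sub>C" 75) where
  "c *\<^sub>C f = Poly_Mapping.map ((*) c) f"

definition tl_comp :: "tl \<Rightarrow> tl \<Rightarrow> tl"  (infixl "\<odot>" 70) where
  "f \<odot> g = (\<Sum>F\<in>Poly_Mapping.keys f. \<Sum>E\<in>Poly_Mapping.keys g.
     Poly_Mapping.single (diagram_comp F E)
       (Poly_Mapping.lookup f F * Poly_Mapping.lookup g E * loop_value ^ diagram_loops F E))"

definition tl_tensor :: "tl \<Rightarrow> tl \<Rightarrow> tl"  (infixl "\<otimes>" 75) where
  "f \<otimes> g = (\<Sum>E\<in>Poly_Mapping.keys f. \<Sum>F\<in>Poly_Mapping.keys g.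
     Poly_Mapping.single (diagram_tensor E F)
       (Poly_Mapping.lookup f E * Poly_Mapping.lookup g F))"

definition tl_adjoint :: "tl \<Rightarrow> tl" where
  "tl_adjoint f = (\<Sum>E\<in>Poly_Mapping.keys f.
     Poly_Mapping.single (diagram_reflect E) (cnj (Poly_Mapping.lookup f E)))"

definition tl_id :: "nat \<Rightarrow> tl" where
  "tl_id n = Poly_Mapping.single (n, n, {{(0, i), (1, i)} | i. i < n}) 1"

definition tl_cup :: "nat \<Rightarrow> tl" where
  "tl_cup n = Poly_Mapping.single (0, 2 * n, {{(1, i), (1, 2 * n - 1 - i)} | i. i < n}) 1"

definition tl_e :: tl where
  "tl_e = tl_cup 1 \<odot> tl_adjoint (tl_cup 1)"

text \<open>The inner product of vectors in the space of morphisms from 0 to n.\<close>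

definition tl_inner :: "tl \<Rightarrow> tl \<Rightarrow> complex" where
  "tl_inner x y = Poly_Mapping.lookup (tl_adjoint x \<odot> y) (0, 0, {})"

text \<open>
  Equality of such vectors up to negligible morphisms: at a root of unity the
  Temperley-Lieb-Jones theory is the quotient by these.
\<close>

definition tlj_eq :: "nat \<Rightarrow> tl \<Rightarrow> tl \<Rightarrow> bool" where
  "tlj_eq n x y \<longleftrightarrow> (\<forall>g\<in>tl_hom n 0. g \<odot> x = g \<odot> y)"

section \<open>Jones-Wenzl projectors and fusion trees\<close>

fun chebyshev :: "nat \<Rightarrow> complex" where
  "chebyshev 0 = 1"
| "chebyshev (Suc 0) = loop_value"
| "chebyshev (Suc (Suc n)) = loop_value * chebyshev (Suc n) - chebyshev n"

fun jones_wenzl :: "nat \<Rightarrow> tl" where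
  "jones_wenzl 0 = tl_id 0"
| "jones_wenzl (Suc 0) = tl_id 1"
| "jones_wenzl (Suc (Suc n)) =
     (let p = jones_wenzl (Suc n) \<otimes> tl_id 1
      in p - (chebyshev n / chebyshev (Suc n)) *\<^sub>C (p \<odot> (tl_id n \<otimes> tl_e) \<odot> p))"

definition admissible :: "nat \<Rightarrow> nat \<Rightarrow> nat \<Rightarrow> bool" where
  "admissible a b c \<longleftrightarrow>
     even (a + b + c) \<and> a \<le> b + c \<and> b \<le> a + c \<and> c \<le> a + b \<and> a + b + c \<le> 8"

text \<open>The trivalent vertex, as a morphism from c to a + b; meaningful for admissible triples.\<close>

definition vertex :: "nat \<Rightarrow> nat \<Rightarrow> nat \<Rightarrow> tl" where
  "vertex a b c =
     (jones_wenzl a \<otimes> jones_wenzl b)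
     \<odot> (tl_id ((a + c - b) div 2) \<otimes> tl_cup ((a + b - c) div 2) \<otimes> tl_id ((b + c - a) div 2))
     \<odot> jones_wenzl c"

definition fusion_tree :: "nat \<Rightarrow> nat \<Rightarrow> nat \<Rightarrow> nat \<Rightarrow> nat \<Rightarrow> tl" where
  "fusion_tree a1 a2 a3 a4 c = (vertex a1 a2 c \<otimes> vertex a3 a4 c) \<odot> vertex c c 0"

definition fusion_labels :: "nat \<Rightarrow> nat \<Rightarrow> nat \<Rightarrow> nat \<Rightarrow> nat set" where
  "fusion_labels a1 a2 a3 a4 = {c. admissible a1 a2 c \<and> admissible a3 a4 c \<and> admissible c c 0}"

definition fusion_state :: "nat \<Rightarrow> nat \<Rightarrow> nat \<Rightarrow> nat \<Rightarrow> nat \<Rightarrow> tl" where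
  "fusion_state a1 a2 a3 a4 c =
     (let t = fusion_tree a1 a2 a3 a4 c in of_real (1 / sqrt (Re (tl_inner t t))) *\<^sub>C t)"

definition state_space :: "nat \<Rightarrow> nat \<Rightarrow> nat \<Rightarrow> nat \<Rightarrow> tl set" where
  "state_space a1 a2 a3 a4 =
     (\<lambda>x. (jones_wenzl a1 \<otimes> jones_wenzl a2 \<otimes> jones_wenzl a3 \<otimes> jones_wenzl a4) \<odot> x)
       ` tl_hom 0 (a1 + a2 + a3 + a4)"

definition state_eq :: "nat \<Rightarrow> nat \<Rightarrow> nat \<Rightarrow> nat \<Rightarrow> tl \<Rightarrow> tl \<Rightarrow> bool" where
  "state_eq a1 a2 a3 a4 = tlj_eq (a1 + a2 + a3 + a4)"

definition fusion_states_orthonormal_basis :: "nat \<Rightarrow> nat \<Rightarrow> nat \<Rightarrow> nat \<Rightarrow> bool" where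
  "fusion_states_orthonormal_basis a1 a2 a3 a4 \<longleftrightarrow>
     (let J = fusion_labels a1 a2 a3 a4; v = fusion_state a1 a2 a3 a4 in
       (\<forall>c\<in>J. v c \<in> state_space a1 a2 a3 a4) \<and>
       (\<forall>c\<in>J. \<forall>c'\<in>J. tl_inner (v c) (v c') = (if c = c' then 1 else 0)) \<and>
       (\<forall>x\<in>state_space a1 a2 a3 a4. \<exists>k. state_eq a1 a2 a3 a4 x (\<Sum>c\<in>J. k c *\<^sub>C v c)))"

section \<open>Braiding\<close>

text \<open>The Kauffman bracket resolution of a crossing.\<close>

definition crossing :: tl where
  "crossing = kauffman_A *\<^sub>C tl_id 2 + inverse kauffman_A *\<^sub>C tl_e"

text \<open>One strand moving from the left to the right of n strands, then m strands doing so.\<close>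

fun braid_one :: "nat \<Rightarrow> tl" where
  "braid_one 0 = tl_id 1"
| "braid_one (Suc n) = (tl_id n \<otimes> crossing) \<odot> (braid_one n \<otimes> tl_id 1)"

fun braid :: "nat \<Rightarrow> nat \<Rightarrow> tl" where
  "braid 0 n = tl_id n"
| "braid (Suc m) n = (braid m n \<otimes> tl_id 1) \<odot> (tl_id m \<otimes> braid_one n)"

text \<open>
  The full twist of the second and third of four anyons. All crossings in both factors have the
  same sign, so one anyon goes once completely around the other.
\<close>

definition full_twist_23 :: "nat \<Rightarrow> nat \<Rightarrow> nat \<Rightarrow> nat \<Rightarrow> tl" where
  "full_twist_23 a1 a2 a3 a4 = tl_id a1 \<otimes> (braid a3 a2 \<odot> braid a2 a3) \<otimes> tl_id a4"

end

(* In Hom(0, 6) two of the five planar diagrams survive the Jones-Wenzl projectors of charges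
   2, 2, 1, 1, and both fusion trees t0, t2 are combinations of their projections. With q = A^2, a
   primitive 12th root of unity, everything has coefficients in Z[q] up to powers of 3 and A, and
   the exact multiplication of diagrams gives norms 2 sqrt 3 and 2 / sqrt 3 for t0 and t2 and
     twist t0 = k t2,   twist t2 = (k / 3) t0,   |k| = sqrt 3,
   already before negligible morphisms are divided out. Compositions of diagrams are evaluated
   on lists of arcs, where the components of a glued diagram arise by merging arcs one at a time. *)

theory Submission
  imports Defs
begin

section \<open>Connected components by successive merging\<close>

text \<open>The reason for the swap: charges 2 and 1 fuse to 1 or 3, and the eigenvalues of their
  full twist on these two channels have ratio A^12 = -1. The quantum dimensions of the charges 1, 2,
  3 are sqrt 3, 2, sqrt 3, so each channel has weight sqrt 3 / (2 sqrt 3) = 1/2 in either basis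
  state, and the diagonal entries of the twist cancel. The proof does not pass through this second
  fusion basis; it verifies the resulting matrix directly. The obstacle is that the defining notions
  do not evaluate: components form a quotient, diagrams are sets of sets, morphisms are finitely
  supported functions on them. Each operation therefore gets a counterpart on lists together with a
  soundness lemma, and what remains is a handful of closed identities decided by rewriting. Exact
  identities suffice because level 4 removes neither of the generic channels 0 and 2: the Gram
  matrix of the two trees is diagonal with positive entries, so no combination of them is
  negligible.\<close>

definition linked :: "'a set set \<Rightarrow> ('a \<times> 'a) set" where
  "linked G = {(x, y). \<exists>B\<in>G. x \<in> B \<and> y \<in> B}"

text \<open>An invariant in place of the quotient, suited to adding one arc at a time: placing every
  arc inside one block keeps the blocks from being too small, and the last condition keeps them from
  being too large.\<close>

definition is_components :: "'a set set \<Rightarrow> 'a set set \<Rightarrow> bool" where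
  "is_components G \<C> \<longleftrightarrow>
     \<Union>\<C> = \<Union>G \<and> {} \<notin> \<C> \<and> (\<forall>C\<in>\<C>. \<forall>D\<in>\<C>. C \<inter> D \<noteq> {} \<longrightarrow> C = D) \<and>
     (\<forall>B\<in>G. \<exists>C\<in>\<C>. B \<subseteq> C) \<and> (\<forall>C\<in>\<C>. C \<times> C \<subseteq> (linked G)\<^sup>*)"

lemma is_componentsD:
  assumes "is_components G \<C>"
  shows "\<Union>\<C> = \<Union>G" "{} \<notin> \<C>"
    "C \<in> \<C> \<Longrightarrow> D \<in> \<C> \<Longrightarrow> C \<inter> D \<noteq> {} \<Longrightarrow> C = D"
    "B \<in> G \<Longrightarrow> \<exists>C\<in>\<C>. B \<subseteq> C"
    "C \<in> \<C> \<Longrightarrow> C \<times> C \<subseteq> (linked G)\<^sup>*"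
  using assms unfolding is_components_def by meson+

text \<open>By disjointness an arc that meets a block lies inside it, so blocks are closed under
  paths; conversely any two points of a block are linked. Each block is thus one full equivalence
  class.\<close>

lemma components_eqI:
  assumes "is_components G \<C>"
  shows "components G = \<C>"
proof -
  note G = is_componentsD[OF assms]
  have closed: "y \<in> C" if "(x, y) \<in> (linked G)\<^sup>*" "C \<in> \<C>" "x \<in> C" for x y C
    using that
  proof (induction rule: rtrancl_induct)
    case (step y z)
    then obtain B where B: "B \<in> G" "y \<in> B" "z \<in> B" by (auto simp: linked_def)
    then obtain D where "D \<in> \<C>" "B \<subseteq> D" using G(4) by meson
    then show ?case using G(3)[of C D] step B by blast
  qed
  have img: "(linked G)\<^sup>* `` {x} = C" if "C \<in> \<C>" "x \<in> C" for x C
    using that G(5)[of C] closed by blast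
  have comp: "components G = \<Union>G // (linked G)\<^sup>*"
    by (simp add: components_def linked_def)
  show ?thesis
  proof (intro set_eqI iffI)
    fix C assume "C \<in> components G"
    then obtain x where x: "x \<in> \<Union>G" "C = (linked G)\<^sup>* `` {x}"
      unfolding comp by (elim quotientE)
    then obtain D where "D \<in> \<C>" "x \<in> D" unfolding G(1)[symmetric] by blast
    then show "C \<in> \<C>" using img x by simp
  next
    fix C assume C: "C \<in> \<C>"
    then obtain x where x: "x \<in> C" using G(2) by (cases "C = {}") auto
    then have "x \<in> \<Union>G" using G(1) C by blast
    then show "C \<in> components G"
      unfolding comp using img[OF C x] by (metis quotientI)
  qed
qed

text \<open>The new arc fuses exactly the blocks that it meets. A point \<open>b\<close> of the arc
  serves as a hub: every point of the merged block \<open>M\<close> is linked to \<open>b\<close> in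
  both directions.\<close>

lemma is_components_insert:
  assumes "is_components G \<C>" "B \<noteq> {}"
  shows "is_components (insert B G)
    (insert (B \<union> \<Union>{C \<in> \<C>. C \<inter> B \<noteq> {}}) {C \<in> \<C>. C \<inter> B = {}})"
proof -
  note G = is_componentsD[OF assms(1)]
  define M where "M = B \<union> \<Union>{C \<in> \<C>. C \<inter> B \<noteq> {}}"
  define L where "L = (linked (insert B G))\<^sup>*"
  have mono: "(linked G)\<^sup>* \<subseteq> L"
    unfolding L_def linked_def by (rule rtrancl_mono) blast
  have BL: "B \<times> B \<subseteq> L"
    unfolding L_def linked_def by (blast intro: r_into_rtrancl)
  have trans: "(x, z) \<in> L" if "(x, y) \<in> L" "(y, z) \<in> L" for x y z
    using that unfolding L_def by (rule rtrancl_trans)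
  obtain b where b: "b \<in> B" using assms(2) by blast
  have to_b: "(x, b) \<in> L \<and> (b, x) \<in> L" if x: "x \<in> M" for x
  proof (cases "x \<in> B")
    case True
    then show ?thesis using b BL by blast
  next
    case False
    then obtain C y where C: "C \<in> \<C>" "x \<in> C" "y \<in> C" "y \<in> B" using x M_def by blast
    then have "(x, y) \<in> L" "(y, x) \<in> L" using G(5)[OF C(1)] mono by blast+
    moreover have "(y, b) \<in> L" "(b, y) \<in> L" using C b BL by blast+
    ultimately show ?thesis using trans by meson
  qed
  have disjoint: "D \<inter> M = {}" if D: "D \<in> \<C>" "D \<inter> B = {}" for D
  proof (rule ccontr)
    assume "D \<inter> M \<noteq> {}"
    then obtain C where "C \<in> \<C>" "C \<inter> B \<noteq> {}" "D \<inter> C \<noteq> {}" using D M_def by blast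
    then show False using G(3)[of D C] D by blast
  qed
  show ?thesis
    unfolding is_components_def M_def[symmetric] L_def[symmetric]
  proof (intro conjI ballI impI)
    show "\<Union>(insert M {C \<in> \<C>. C \<inter> B = {}}) = \<Union>(insert B G)"
      unfolding M_def Union_insert G(1)[symmetric] by blast
    show "{} \<notin> insert M {C \<in> \<C>. C \<inter> B = {}}"
      using G(2) b M_def by blast
  next
    fix C D
    assume C: "C \<in> insert M {C \<in> \<C>. C \<inter> B = {}}" and D: "D \<in> insert M {C \<in> \<C>. C \<inter> B = {}}"
      and meet: "C \<inter> D \<noteq> {}"
    consider "C = M" "D = M" | "C \<in> \<C>" "C \<inter> B = {}" "D = M" | "D \<in> \<C>" "D \<inter> B = {}" "C = M"
      | "C \<in> \<C>" "D \<in> \<C>"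
      using C D by blast
    then show "C = D"
      using disjoint[of C] disjoint[of D] G(3)[of C D] meet by cases (simp_all add: Int_commute)
  next
    fix B' assume "B' \<in> insert B G"
    then consider "B' = B" | "B' \<in> G" by blast
    then show "\<exists>C\<in>insert M {C \<in> \<C>. C \<inter> B = {}}. B' \<subseteq> C"
    proof cases
      case 1
      then show ?thesis using M_def by blast
    next
      case 2
      then obtain C where C: "C \<in> \<C>" "B' \<subseteq> C" using G(4) by meson
      show ?thesis
      proof (cases "C \<inter> B = {}")
        case True
        then show ?thesis using C by (intro bexI[of _ C]) simp_all
      next
        case False
        then have "C \<subseteq> M" using C(1) M_def by blast
        then show ?thesis using C(2) by (intro bexI[of _ M]) simp_all
      qed
    qed
  next
    fix C assume "C \<in> insert M {C \<in> \<C>. C \<inter> B = {}}"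
    then consider "C = M" | "C \<in> \<C>" by blast
    then show "C \<times> C \<subseteq> L"
    proof cases
      case 1
      then show ?thesis using to_b trans by blast
    next
      case 2
      then show ?thesis using G(5) mono by blast
    qed
  qed
qed

text \<open>Points shared by an arc and the blocks it joins are repeated in the concatenation. Only
  the underlying sets matter, and \<open>sort_diagram\<close> removes the repetitions later.\<close>

fun merge_blocks :: "'a list list \<Rightarrow> 'a list list" where
  "merge_blocks [] = []"
| "merge_blocks (B # Bs) =
     (let Cs = merge_blocks Bs
      in (B @ concat (filter (list_ex (\<lambda>x. x \<in> set B)) Cs))
           # filter (\<lambda>C. \<not> list_ex (\<lambda>x. x \<in> set B) C) Cs)"

lemma is_components_merge_blocks:
  "[] \<notin> set Bs \<Longrightarrow> is_components (set ` set Bs) (set ` set (merge_blocks Bs))"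
proof (induction Bs)
  case Nil
  then show ?case by (simp add: is_components_def)
next
  case (Cons B Bs)
  let ?C = "set ` set (merge_blocks Bs)"
  have ex: "list_ex (\<lambda>x. x \<in> set B) C \<longleftrightarrow> set C \<inter> set B \<noteq> {}" for C
    by (auto simp: list_ex_iff)
  have "set ` set (merge_blocks (B # Bs)) =
      insert (set B \<union> \<Union>{C \<in> ?C. C \<inter> set B \<noteq> {}}) {C \<in> ?C. C \<inter> set B = {}}"
    by (auto simp: Let_def ex)
  moreover have "is_components (insert (set B) (set ` set Bs)) \<dots>"
    using Cons by (intro is_components_insert) auto
  ultimately show ?case by simp
qed

lemma components_merge_blocks:
  "[] \<notin> set Bs \<Longrightarrow> components (set ` set Bs) = set ` set (merge_blocks Bs)"
  by (intro components_eqI is_components_merge_blocks)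

text \<open>Needed to count loops by the length of a list instead of the cardinality of a set. The
  merged block contains a point of \<open>B\<close>, whereas the blocks left alone avoid
  \<open>B\<close>.\<close>

lemma distinct_merge_blocks:
  "[] \<notin> set Bs \<Longrightarrow> distinct (map set (merge_blocks Bs))"
proof (induction Bs)
  case (Cons B Bs)
  have *: "set B \<union> X \<noteq> set C" if "\<not> list_ex (\<lambda>x. x \<in> set B) C" for X C
  proof -
    obtain b where "b \<in> set B" using Cons.prems by (cases B) auto
    then show ?thesis using that by (auto simp: list_ex_iff)
  qed
  have "distinct (map set (filter P (merge_blocks Bs)))" for P
    using Cons by (simp add: distinct_map_filter)
  then show ?case using * by (auto simp: Let_def)
qed simp

section \<open>Diagrams as lists\<close>

type_synonym list_diagram = "nat \<times> nat \<times> point list list"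

definition diagram_of :: "list_diagram \<Rightarrow> diagram" where
  "diagram_of = (\<lambda>(m, n, L). (m, n, set ` set L))"

definition glue_list :: "point list list \<Rightarrow> point list list \<Rightarrow> point list list" where
  "glue_list F E = E @ map (map (\<lambda>(l, i). (Suc l, i))) F"

definition outer_list :: "point list \<Rightarrow> point list" where
  "outer_list C = map (\<lambda>(l, i). (if l = 0 then 0 else 1, i)) (filter (\<lambda>(l, i). l \<noteq> 1) C)"

text \<open>The value 10 exceeds all indices that occur; the order only serves to make equal
  diagrams have equal lists, soundness does not depend on it.\<close>

definition point_key :: "point \<Rightarrow> nat" where
  "point_key = (\<lambda>(l, i). if l = 0 then i else 10 + i)"

definition sort_diagram :: "point list list \<Rightarrow> point list list" where
  "sort_diagram L =
     sort_key (\<lambda>C. point_key (hd C)) (map (\<lambda>C. sort_key point_key (remdups C)) L)"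

definition comp_diagram :: "list_diagram \<Rightarrow> list_diagram \<Rightarrow> list_diagram" where
  "comp_diagram = (\<lambda>(_, k, F) (m, _, E).
     (m, k, sort_diagram (filter (\<lambda>C. C \<noteq> []) (map outer_list (merge_blocks (glue_list F E))))))"

definition loops_diagram :: "list_diagram \<Rightarrow> list_diagram \<Rightarrow> nat" where
  "loops_diagram = (\<lambda>(_, _, F) (_, _, E).
     length (filter (\<lambda>C. outer_list C = []) (merge_blocks (glue_list F E))))"

definition tensor_diagram :: "list_diagram \<Rightarrow> list_diagram \<Rightarrow> list_diagram" where
  "tensor_diagram = (\<lambda>(m, n, E) (m', n', F).
     (m + m', n + n',
      sort_diagram (E @ map (map (\<lambda>(l, i). (l, (if l = 0 then m else n) + i))) F)))"

definition reflect_diagram :: "list_diagram \<Rightarrow> list_diagram" where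
  "reflect_diagram = (\<lambda>(m, n, E). (n, m, sort_diagram (map (map (\<lambda>(l, i). (1 - l, i))) E)))"

text \<open>An empty arc would survive merging as an empty block, which is no component.\<close>

definition proper :: "list_diagram \<Rightarrow> bool" where
  "proper = (\<lambda>(m, n, L). [] \<notin> set L)"

lemma set_sort_diagram [simp]: "set ` set (sort_diagram L) = set ` set L"
  by (simp add: sort_diagram_def image_image)

lemma Nil_in_sort_diagram [simp]: "[] \<in> set (sort_diagram L) \<longleftrightarrow> [] \<in> set L"
proof -
  have "[] \<in> set M \<longleftrightarrow> {} \<in> set ` set M" for M :: "point list list" by auto
  then show ?thesis by (metis set_sort_diagram)
qed

lemma set_outer_list: "set (outer_list C) = outer_points (set C)"
  unfolding outer_list_def outer_points_def by (force simp: image_iff)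

lemma outer_list_Nil: "outer_list C = [] \<longleftrightarrow> outer_points (set C) = {}"
  by (metis set_outer_list set_empty)

lemma set_glue_list: "set ` set (glue_list F E) = glue (set ` set F) (set ` set E)"
  by (simp add: glue_list_def glue_def image_Un image_image)

lemma proper_glue: "proper (m, n, F) \<Longrightarrow> proper (m', n', E) \<Longrightarrow> [] \<notin> set (glue_list F E)"
  by (auto simp: proper_def glue_list_def)

text \<open>A closed loop has no outer points, so dropping empty lists corresponds to removing the
  empty set from the image of the components.\<close>

lemma diagram_of_comp:
  assumes "proper D" "proper D'"
  shows "diagram_of (comp_diagram D D') = diagram_comp (diagram_of D) (diagram_of D')"
proof -
  obtain n k F m n' E where D: "D = (n, k, F)" "D' = (m, n', E)" by (cases D, cases D') auto
  have "set ` set (filter (\<lambda>C. C \<noteq> []) (map outer_list M)) = set ` outer_list ` set M - {{}}" for M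
    by auto
  then have "set ` set (filter (\<lambda>C. C \<noteq> []) (map outer_list (merge_blocks (glue_list F E)))) =
      outer_points ` components (glue (set ` set F) (set ` set E)) - {{}}"
    using components_merge_blocks[OF proper_glue[OF assms[unfolded D]]]
    unfolding set_glue_list by (simp add: set_outer_list image_image)
  then show ?thesis
    by (simp add: D comp_diagram_def diagram_of_def diagram_comp_def)
qed

lemma diagram_loops_of:
  assumes "proper D" "proper D'"
  shows "diagram_loops (diagram_of D) (diagram_of D') = loops_diagram D D'"
proof -
  obtain n k F m n' E where D: "D = (n, k, F)" "D' = (m, n', E)" by (cases D, cases D') auto
  let ?M = "merge_blocks (glue_list F E)"
  note pr = proper_glue[OF assms[unfolded D]]
  have eq: "{C \<in> set ` set ?M. outer_points C = {}} = set (map set (filter (\<lambda>C. outer_list C = []) ?M))"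
    by (auto simp: outer_list_Nil)
  have "distinct (map set (filter (\<lambda>C. outer_list C = []) ?M))"
    using distinct_merge_blocks[OF pr] by (simp add: distinct_map_filter)
  then have "card {C \<in> set ` set ?M. outer_points C = {}}
      = length (filter (\<lambda>C. outer_list C = []) ?M)"
    unfolding eq by (simp only: distinct_card length_map)
  then show ?thesis
    using components_merge_blocks[OF pr]
    by (simp add: D diagram_of_def diagram_loops_def loops_diagram_def set_glue_list)
qed

lemma proper_comp: "proper (comp_diagram D D')"
  by (auto simp: comp_diagram_def proper_def split: prod.splits)

lemma proper_tensor: "proper D \<Longrightarrow> proper D' \<Longrightarrow> proper (tensor_diagram D D')"
  by (auto simp: tensor_diagram_def proper_def split: prod.splits)

lemma proper_reflect: "proper D \<Longrightarrow> proper (reflect_diagram D)"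
  by (auto simp: reflect_diagram_def proper_def split: prod.splits)

lemma diagram_of_tensor:
  "diagram_of (tensor_diagram D D') = diagram_tensor (diagram_of D) (diagram_of D')"
  by (cases D, cases D')
    (simp add: tensor_diagram_def diagram_of_def diagram_tensor_def image_Un image_image)

lemma diagram_of_reflect: "diagram_of (reflect_diagram D) = diagram_reflect (diagram_of D)"
  by (cases D) (simp add: reflect_diagram_def diagram_of_def diagram_reflect_def image_image)

section \<open>Linear structure\<close>

text \<open>Cancellation can shrink the support of a sum or a multiple, so the index sets in
  \<open>tl_comp\<close> and \<open>tl_tensor\<close> do not behave additively. Enlarging them to a
  common finite set costs nothing, since zero coefficients contribute zero.\<close>

lemma sum_keys_superset:
  assumes "finite S" "Poly_Mapping.keys f \<subseteq> S" "\<And>k. h k 0 = 0"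
  shows "(\<Sum>k\<in>Poly_Mapping.keys f. h k (Poly_Mapping.lookup f k))
    = (\<Sum>k\<in>S. h k (Poly_Mapping.lookup f k))"
  using assms by (intro sum.mono_neutral_left) (auto simp: in_keys_iff)

lemma sum_keys_add:
  assumes "\<And>k. h k 0 = 0" "\<And>k a b. h k (a + b) = h k a + h k b"
  shows "(\<Sum>k\<in>Poly_Mapping.keys (f + g). h k (Poly_Mapping.lookup (f + g) k))
    = (\<Sum>k\<in>Poly_Mapping.keys f. h k (Poly_Mapping.lookup f k))
      + (\<Sum>k\<in>Poly_Mapping.keys g. h k (Poly_Mapping.lookup g k))"
proof -
  let ?S = "Poly_Mapping.keys f \<union> Poly_Mapping.keys g"
  have S: "finite ?S" "Poly_Mapping.keys (f + g) \<subseteq> ?S" "Poly_Mapping.keys f \<subseteq> ?S"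
    "Poly_Mapping.keys g \<subseteq> ?S"
    by (auto simp: Poly_Mapping.keys_add)
  show ?thesis
    unfolding sum_keys_superset[where h = h, OF S(1,2) assms(1)]
      sum_keys_superset[where h = h, OF S(1,3) assms(1)]
      sum_keys_superset[where h = h, OF S(1,4) assms(1)]
    by (simp add: lookup_add assms(2) sum.distrib)
qed

lemma lookup_tl_scale [simp]:
  "Poly_Mapping.lookup (c *\<^sub>C f) k = c * Poly_Mapping.lookup f k"
  by (simp add: tl_scale_def Poly_Mapping.map.rep_eq when_def)

lemma tl_scale_tl_scale [simp]: "a *\<^sub>C (b *\<^sub>C f) = (a * b) *\<^sub>C f"
  by (rule poly_mapping_eqI) simp

lemma tl_scale_one [simp]: "1 *\<^sub>C f = f"
  by (rule poly_mapping_eqI) simp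

lemma tl_scale_zero [simp]: "a *\<^sub>C 0 = 0"
  by (rule poly_mapping_eqI) simp

lemma tl_scale_add: "a *\<^sub>C (f + g) = a *\<^sub>C f + a *\<^sub>C g"
  by (rule poly_mapping_eqI) (simp add: lookup_add algebra_simps)

lemma tl_scale_single: "a *\<^sub>C Poly_Mapping.single D c = Poly_Mapping.single D (a * c)"
  by (rule poly_mapping_eqI) (simp add: lookup_single when_def)

lemma keys_tl_scale: "Poly_Mapping.keys (a *\<^sub>C f) \<subseteq> Poly_Mapping.keys f"
  by (auto simp: in_keys_iff)

lemma tl_scale_sum: "a *\<^sub>C sum H S = (\<Sum>k\<in>S. a *\<^sub>C H k)"
  by (induction S rule: infinite_finite_induct) (simp_all add: tl_scale_add)

lemma sum_keys_scale:
  assumes "\<And>k. h k 0 = 0" "\<And>k b. h k (a * b) = a *\<^sub>C h k b"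
  shows "(\<Sum>k\<in>Poly_Mapping.keys (a *\<^sub>C f). h k (Poly_Mapping.lookup (a *\<^sub>C f) k))
    = a *\<^sub>C (\<Sum>k\<in>Poly_Mapping.keys f. h k (Poly_Mapping.lookup f k))"
  unfolding sum_keys_superset[where h = h, OF finite_keys keys_tl_scale assms(1)]
  by (simp add: assms(2) tl_scale_sum)

section \<open>Linearity of composition, tensor product and adjoint\<close>

lemma tl_comp_add_left: "(f + f') \<odot> g = f \<odot> g + f' \<odot> g"
  unfolding tl_comp_def
  by (rule sum_keys_add) (simp_all add: ring_distribs single_add sum.distrib)

lemma tl_comp_add_right: "f \<odot> (g + g') = f \<odot> g + f \<odot> g'"
  unfolding tl_comp_def sum.distrib[symmetric]
  by (intro sum.cong refl sum_keys_add) (simp_all add: ring_distribs single_add)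

lemma tl_comp_scale_left: "(a *\<^sub>C f) \<odot> g = a *\<^sub>C (f \<odot> g)"
  unfolding tl_comp_def
  by (rule sum_keys_scale) (simp_all add: tl_scale_sum tl_scale_single mult.assoc)

lemma tl_comp_scale_right: "f \<odot> (a *\<^sub>C g) = a *\<^sub>C (f \<odot> g)"
  unfolding tl_comp_def tl_scale_sum[of _ _ "Poly_Mapping.keys f"]
  by (intro sum.cong refl sum_keys_scale) (simp_all add: tl_scale_single mult_ac)

lemma tl_tensor_add_left: "(f + f') \<otimes> g = f \<otimes> g + f' \<otimes> g"
  unfolding tl_tensor_def
  by (rule sum_keys_add) (simp_all add: ring_distribs single_add sum.distrib)

lemma tl_tensor_add_right: "f \<otimes> (g + g') = f \<otimes> g + f \<otimes> g'"
  unfolding tl_tensor_def sum.distrib[symmetric]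
  by (intro sum.cong refl sum_keys_add) (simp_all add: ring_distribs single_add)

lemma tl_tensor_scale_left: "(a *\<^sub>C f) \<otimes> g = a *\<^sub>C (f \<otimes> g)"
  unfolding tl_tensor_def
  by (rule sum_keys_scale) (simp_all add: tl_scale_sum tl_scale_single mult.assoc)

lemma tl_tensor_scale_right: "f \<otimes> (a *\<^sub>C g) = a *\<^sub>C (f \<otimes> g)"
  unfolding tl_tensor_def tl_scale_sum[of _ _ "Poly_Mapping.keys f"]
  by (intro sum.cong refl sum_keys_scale) (simp_all add: tl_scale_single mult_ac)

lemma tl_adjoint_add: "tl_adjoint (f + g) = tl_adjoint f + tl_adjoint g"
  unfolding tl_adjoint_def by (rule sum_keys_add) (simp_all add: single_add)

lemma tl_adjoint_scale: "tl_adjoint (a *\<^sub>C f) = cnj a *\<^sub>C tl_adjoint f"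
proof -
  let ?h = "\<lambda>E c. Poly_Mapping.single (diagram_reflect E) (cnj c) :: tl"
  show ?thesis
    using sum_keys_superset[where h = ?h and f = "a *\<^sub>C f", OF finite_keys keys_tl_scale]
    by (simp add: tl_adjoint_def tl_scale_sum tl_scale_single)
qed

lemma tl_comp_single:
  "Poly_Mapping.single D a \<odot> Poly_Mapping.single E b
    = Poly_Mapping.single (diagram_comp D E) (a * b * loop_value ^ diagram_loops D E)"
  by (simp add: tl_comp_def)

lemma tl_tensor_single:
  "Poly_Mapping.single D a \<otimes> Poly_Mapping.single E b
    = Poly_Mapping.single (diagram_tensor D E) (a * b)"
  by (simp add: tl_tensor_def)

lemma tl_adjoint_single:
  "tl_adjoint (Poly_Mapping.single D a) = Poly_Mapping.single (diagram_reflect D) (cnj a)"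
  by (simp add: tl_adjoint_def)

lemma tl_zero [simp]:
  "0 \<odot> f = 0" "f \<odot> 0 = 0" "0 \<otimes> f = 0" "f \<otimes> 0 = 0" "tl_adjoint 0 = 0"
  by (simp_all add: tl_comp_def tl_tensor_def tl_adjoint_def)

section \<open>Coefficients\<close>

definition kauffman_q :: complex where
  "kauffman_q = kauffman_A ^ 2"

lemma kauffman_A_nonzero: "kauffman_A \<noteq> 0"
  by (simp add: kauffman_A_def)

lemma norm_kauffman_A: "cmod kauffman_A = 1"
  by (simp add: kauffman_A_def norm_mult)

lemma kauffman_q_eq: "kauffman_q = Complex (- sqrt 3 / 2) (1 / 2)"
proof -
  have "exp (- (\<i> * of_real (pi / 12))) ^ 2 = cis (- (pi / 6))"
    by (simp add: cis_conv_exp exp_of_nat_mult[symmetric] flip: exp_of_nat_mult)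
  then show ?thesis
    by (simp add: kauffman_q_def kauffman_A_def power_mult_distrib complex_eq_iff cos_30 sin_30)
qed

lemma kauffman_q_sqrt3: "sqrt 3 * (sqrt 3 * x) = 3 * x" for x :: real
  by (simp flip: mult.assoc)

text \<open>The 12th cyclotomic polynomial x^4 - x^2 + 1 vanishes at q; every reduction of
  coefficients rests on this.\<close>

lemma kauffman_q_power4: "kauffman_q ^ 4 = kauffman_q ^ 2 - 1"
  unfolding kauffman_q_eq
  by (simp add: complex_eq_iff power2_eq_square power4_eq_xxxx field_simps kauffman_q_sqrt3)

lemma kauffman_q_power6: "kauffman_q ^ 6 = - 1"
proof -
  have "kauffman_q ^ 6 = kauffman_q ^ 2 * kauffman_q ^ 4"
    by (simp flip: power_add)
  also have "\<dots> = kauffman_q ^ 4 - kauffman_q ^ 2"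
    unfolding kauffman_q_power4 by (simp add: algebra_simps kauffman_q_power4 flip: power_add)
  also have "\<dots> = - 1" unfolding kauffman_q_power4 by simp
  finally show ?thesis .
qed

text \<open>As q lies on the unit circle, its conjugate is its inverse, and q (q - q^3) = q^2 - q^4
  = 1.\<close>

lemma cnj_kauffman_q: "cnj kauffman_q = kauffman_q - kauffman_q ^ 3"
  by (simp only: kauffman_q_eq)
    (simp add: complex_eq_iff power3_eq_cube field_simps kauffman_q_sqrt3)

lemma loop_value_eq: "loop_value = kauffman_q ^ 3 - 2 * kauffman_q"
proof -
  have "kauffman_q * (kauffman_q - kauffman_q ^ 3) = 1"
    using kauffman_q_power4 by (simp add: algebra_simps eval_nat_numeral)
  then have "inverse kauffman_q = kauffman_q - kauffman_q ^ 3"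
    by (metis inverse_unique)
  then show ?thesis by (simp add: loop_value_def flip: kauffman_q_def)
qed

lemma loop_value_sqrt: "loop_value = of_real (sqrt 3)"
  unfolding loop_value_eq kauffman_q_eq
  by (simp add: complex_eq_iff power3_eq_cube field_simps kauffman_q_sqrt3)

text \<open>The quadruple (a, b, c, e) stands for a + b q + c q^2 + e q^3 in the ring of integers of the
  12th cyclotomic field, where q = A^2 satisfies q^4 = q^2 - 1.\<close>

type_synonym coeff = "int \<times> int \<times> int \<times> int"

definition coeff_val :: "coeff \<Rightarrow> complex" where
  "coeff_val = (\<lambda>(a, b, c, e).
     of_int a + of_int b * kauffman_q + of_int c * kauffman_q ^ 2 + of_int e * kauffman_q ^ 3)"

definition coeff_add :: "coeff \<Rightarrow> coeff \<Rightarrow> coeff" where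
  "coeff_add = (\<lambda>(a, b, c, e) (a', b', c', e'). (a + a', b + b', c + c', e + e'))"

text \<open>\<open>c4\<close>, \<open>c5\<close>, \<open>c6\<close> are the coefficients of q^4,
  q^5, q^6 in the product, folded back by q^4 = q^2 - 1, q^5 = q^3 - q and q^6 = -1.\<close>

definition coeff_mult :: "coeff \<Rightarrow> coeff \<Rightarrow> coeff" where
  "coeff_mult = (\<lambda>(a, b, c, e) (a', b', c', e').
     let c4 = b * e' + c * c' + e * b'; c5 = c * e' + e * c'; c6 = e * e'
     in (a * a' - c4 - c6, a * b' + b * a' - c5, a * c' + b * b' + c * a' + c4,
         a * e' + b * c' + c * b' + e * a' + c5))"

text \<open>Conjugation sends q, q^2, q^3 to q - q^3, 1 - q^2, -q^3.\<close>

definition coeff_cnj :: "coeff \<Rightarrow> coeff" where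
  "coeff_cnj = (\<lambda>(a, b, c, e). (a + c, b, - c, - b - e))"

text \<open>The constant \<open>(0, -2, 0, 1)\<close> is the loop value -q - q^-1 = q^3 - 2 q, that
  is, sqrt 3.\<close>

fun coeff_loops :: "nat \<Rightarrow> coeff" where
  "coeff_loops 0 = (1, 0, 0, 0)"
| "coeff_loops (Suc n) = coeff_mult (0, -2, 0, 1) (coeff_loops n)"

lemma coeff_val_zero: "coeff_val (0, 0, 0, 0) = 0"
  by (simp add: coeff_val_def)

lemma coeff_val_one: "coeff_val (1, 0, 0, 0) = 1"
  by (simp add: coeff_val_def)

lemma coeff_val_add: "coeff_val (coeff_add x y) = coeff_val x + coeff_val y"
  by (cases x, cases y) (simp add: coeff_val_def coeff_add_def ring_distribs)

lemma coeff_val_mult: "coeff_val (coeff_mult x y) = coeff_val x * coeff_val y"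
proof -
  obtain a b c e where x: "x = (a, b, c, e)" by (cases x)
  obtain a' b' c' e' where y: "y = (a', b', c', e')" by (cases y)
  define q where "q = kauffman_q"
  have q4: "q ^ 4 = q ^ 2 - 1" unfolding q_def by (rule kauffman_q_power4)
  have q5: "q ^ 5 = q ^ 3 - q"
    using arg_cong[OF q4, of "\<lambda>t. q * t"] by (simp add: algebra_simps eval_nat_numeral)
  have q6: "q ^ 6 = - 1" unfolding q_def by (rule kauffman_q_power6)
  have "coeff_val x * coeff_val y =
      of_int (a * a') + of_int (a * b' + b * a') * q + of_int (a * c' + b * b' + c * a') * q ^ 2
      + of_int (a * e' + b * c' + c * b' + e * a') * q ^ 3
      + of_int (b * e' + c * c' + e * b') * q ^ 4 + of_int (c * e' + e * c') * q ^ 5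
      + of_int (e * e') * q ^ 6"
    unfolding x y coeff_val_def q_def[symmetric] by (simp add: algebra_simps eval_nat_numeral)
  also have "\<dots> = coeff_val (coeff_mult x y)"
    unfolding x y coeff_val_def coeff_mult_def q_def[symmetric] q4 q5 q6
    by (simp add: Let_def algebra_simps)
  finally show ?thesis by simp
qed

lemma coeff_val_cnj: "coeff_val (coeff_cnj x) = cnj (coeff_val x)"
proof -
  obtain a b c e where x: "x = (a, b, c, e)" by (cases x)
  define q where "q = kauffman_q"
  have q4: "q ^ 4 = q ^ 2 - 1" unfolding q_def by (rule kauffman_q_power4)
  have q6: "q ^ 6 = - 1" unfolding q_def by (rule kauffman_q_power6)
  have c1: "cnj q = q - q ^ 3" unfolding q_def by (rule cnj_kauffman_q)
  have inv: "q * cnj q = 1"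
    unfolding c1 using q4 by (simp add: algebra_simps eval_nat_numeral)
  have c2: "cnj q ^ 2 = 1 - q ^ 2"
  proof -
    have "q ^ 2 * (1 - q ^ 2) = 1" using q4 by (simp add: algebra_simps eval_nat_numeral)
    moreover have "q ^ 2 * cnj q ^ 2 = 1" using inv by (simp flip: power_mult_distrib)
    ultimately show ?thesis by (metis inverse_unique)
  qed
  have c3: "cnj q ^ 3 = - (q ^ 3)"
  proof -
    have "q ^ 3 * (- (q ^ 3)) = 1" using q6 by (simp flip: power_add)
    moreover have "q ^ 3 * cnj q ^ 3 = 1" using inv by (simp flip: power_mult_distrib)
    ultimately show ?thesis by (metis inverse_unique)
  qed
  show ?thesis
    unfolding x coeff_val_def coeff_cnj_def q_def[symmetric]
    by (simp add: c2 c3) (simp add: c1 algebra_simps)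
qed

lemma coeff_val_loops: "coeff_val (coeff_loops n) = loop_value ^ n"
  by (induction n)
    (simp_all only: coeff_loops.simps coeff_val_one coeff_val_mult power_0 power_Suc,
     simp add: coeff_val_def loop_value_eq)

section \<open>Morphisms as lists\<close>

type_synonym list_tl = "(list_diagram \<times> coeff) list"

definition tl_of :: "list_tl \<Rightarrow> tl" where
  "tl_of xs = (\<Sum>(D, c)\<leftarrow>xs. Poly_Mapping.single (diagram_of D) (coeff_val c))"

fun add_term :: "list_diagram \<times> coeff \<Rightarrow> list_tl \<Rightarrow> list_tl" where
  "add_term (D, c) [] = [(D, c)]"
| "add_term (D, c) ((E, e) # xs) =
     (if D = E then (D, coeff_add c e) # xs else (E, e) # add_term (D, c) xs)"

text \<open>Combining like terms keeps the lists short during evaluation and makes cancellation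
  visible, so that a vanishing combination can evaluate to the empty list.\<close>

definition collect_terms :: "list_tl \<Rightarrow> list_tl" where
  "collect_terms xs = filter (\<lambda>(D, c). c \<noteq> (0, 0, 0, 0)) (foldr add_term xs [])"

definition list_comp :: "list_tl \<Rightarrow> list_tl \<Rightarrow> list_tl" where
  "list_comp xs ys = collect_terms (concat (map (\<lambda>(D, c). map (\<lambda>(E, e).
     (comp_diagram D E, coeff_mult (coeff_mult c e) (coeff_loops (loops_diagram D E)))) ys) xs))"

definition list_tensor :: "list_tl \<Rightarrow> list_tl \<Rightarrow> list_tl" where
  "list_tensor xs ys = concat (map (\<lambda>(D, c). map (\<lambda>(E, e).
     (tensor_diagram D E, coeff_mult c e)) ys) xs)"

definition list_adjoint :: "list_tl \<Rightarrow> list_tl" where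
  "list_adjoint = map (\<lambda>(D, c). (reflect_diagram D, coeff_cnj c))"

definition list_scale :: "coeff \<Rightarrow> list_tl \<Rightarrow> list_tl" where
  "list_scale k = map (\<lambda>(D, c). (D, coeff_mult k c))"

definition list_add :: "list_tl \<Rightarrow> list_tl \<Rightarrow> list_tl" where
  "list_add xs ys = collect_terms (xs @ ys)"

definition proper_list :: "list_tl \<Rightarrow> bool" where
  "proper_list xs \<longleftrightarrow> (\<forall>(D, c)\<in>set xs. proper D)"

section \<open>Soundness of the operations on lists of terms\<close>

lemma tl_of_simps [simp]:
  "tl_of [] = 0"
  "tl_of ((D, c) # xs) = Poly_Mapping.single (diagram_of D) (coeff_val c) + tl_of xs"
  "tl_of (xs @ ys) = tl_of xs + tl_of ys"
  by (simp_all add: tl_of_def)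

lemma proper_list_simps [simp]:
  "proper_list []"
  "proper_list ((D, c) # xs) \<longleftrightarrow> proper D \<and> proper_list xs"
  "proper_list (xs @ ys) \<longleftrightarrow> proper_list xs \<and> proper_list ys"
  by (auto simp: proper_list_def)

lemma tl_of_add_term:
  "tl_of (add_term (D, c) xs) = Poly_Mapping.single (diagram_of D) (coeff_val c) + tl_of xs"
  by (induction "(D, c)" xs rule: add_term.induct)
    (auto simp: coeff_val_add single_add add.left_commute)

lemma tl_of_collect_terms: "tl_of (collect_terms xs) = tl_of xs"
proof -
  have "tl_of (filter (\<lambda>(D, c). c \<noteq> (0, 0, 0, 0)) ys) = tl_of ys" for ys
    by (induction ys) (auto simp: coeff_val_zero)
  moreover have "tl_of (foldr add_term xs []) = tl_of xs"
    by (induction xs) (auto simp: tl_of_add_term)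
  ultimately show ?thesis by (simp add: collect_terms_def)
qed

lemma proper_list_add_term:
  "proper D \<Longrightarrow> proper_list xs \<Longrightarrow> proper_list (add_term (D, c) xs)"
  by (induction "(D, c)" xs rule: add_term.induct) auto

lemma proper_list_collect_terms: "proper_list xs \<Longrightarrow> proper_list (collect_terms xs)"
proof -
  assume "proper_list xs"
  then have "proper_list (foldr add_term xs [])"
    by (induction xs) (auto simp: proper_list_add_term)
  then show ?thesis by (auto simp: collect_terms_def proper_list_def)
qed

lemma tl_of_comp:
  assumes "proper_list xs" "proper_list ys"
  shows "tl_of (list_comp xs ys) = tl_of xs \<odot> tl_of ys"
proof -
  have "tl_of (map (\<lambda>(E, e). (comp_diagram D E,
        coeff_mult (coeff_mult c e) (coeff_loops (loops_diagram D E)))) ys)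
      = Poly_Mapping.single (diagram_of D) (coeff_val c) \<odot> tl_of ys" if "proper D" for D c
    using assms(2)
    by (induction ys) (auto simp: that tl_comp_add_right tl_comp_single diagram_of_comp
        diagram_loops_of coeff_val_mult coeff_val_loops)
  with assms(1) show ?thesis
    unfolding list_comp_def tl_of_collect_terms
    by (induction xs) (auto simp: tl_comp_add_left)
qed

lemma tl_of_tensor: "tl_of (list_tensor xs ys) = tl_of xs \<otimes> tl_of ys"
proof -
  have "tl_of (map (\<lambda>(E, e). (tensor_diagram D E, coeff_mult c e)) ys)
      = Poly_Mapping.single (diagram_of D) (coeff_val c) \<otimes> tl_of ys" for D c
    by (induction ys) (auto simp: tl_tensor_add_right tl_tensor_single diagram_of_tensor
        coeff_val_mult)
  then show ?thesis
    unfolding list_tensor_def by (induction xs) (auto simp: tl_tensor_add_left)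
qed

lemma tl_of_adjoint: "tl_of (list_adjoint xs) = tl_adjoint (tl_of xs)"
  unfolding list_adjoint_def
  by (induction xs)
    (auto simp: tl_adjoint_add tl_adjoint_single diagram_of_reflect coeff_val_cnj)

lemma tl_of_scale: "tl_of (list_scale k xs) = coeff_val k *\<^sub>C tl_of xs"
  unfolding list_scale_def
  by (induction xs) (auto simp: tl_scale_add tl_scale_single coeff_val_mult)

lemma tl_of_add: "tl_of (list_add xs ys) = tl_of xs + tl_of ys"
  by (simp add: list_add_def tl_of_collect_terms)

text \<open>The prefactor \<open>s\<close> carries the scalars outside Z[q]: powers of 1/3 from the
  Jones-Wenzl projectors and of A^-1 from the crossings, A being a primitive 24th root of unity. It
  is multiplicative under composition and tensor product, so the list itself stays integral.\<close>

definition represents :: "complex \<Rightarrow> list_tl \<Rightarrow> tl \<Rightarrow> bool" where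
  "represents s xs f \<longleftrightarrow> proper_list xs \<and> f = s *\<^sub>C tl_of xs"

lemma proper_list_comp: "proper_list (list_comp xs ys)"
  unfolding list_comp_def
  by (rule proper_list_collect_terms) (auto simp: proper_list_def proper_comp)

lemma proper_list_tensor: "proper_list xs \<Longrightarrow> proper_list ys \<Longrightarrow> proper_list (list_tensor xs ys)"
  by (auto simp: list_tensor_def proper_list_def intro!: proper_tensor)

lemma represents_comp:
  "represents s xs f \<Longrightarrow> represents t ys g \<Longrightarrow> represents (s * t) (list_comp xs ys) (f \<odot> g)"
  by (auto simp: represents_def tl_of_comp tl_comp_scale_left tl_comp_scale_right
      proper_list_comp mult.commute)

lemma represents_tensor:
  "represents s xs f \<Longrightarrow> represents t ys g \<Longrightarrow> represents (s * t) (list_tensor xs ys) (f \<otimes> g)"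
  by (auto simp: represents_def tl_of_tensor tl_tensor_scale_left tl_tensor_scale_right
      proper_list_tensor mult.commute)

lemma represents_adjoint:
  assumes "represents s xs f"
  shows "represents (cnj s) (list_adjoint xs) (tl_adjoint f)"
proof -
  have "proper_list (list_adjoint xs)"
    using assms by (auto simp: represents_def list_adjoint_def proper_list_def proper_reflect)
  with assms show ?thesis by (auto simp: represents_def tl_of_adjoint tl_adjoint_scale)
qed

lemma represents_scale:
  assumes "represents s xs f"
  shows "represents s (list_scale k xs) (coeff_val k *\<^sub>C f)"
proof -
  have "proper_list (list_scale k xs)"
    using assms by (auto simp: represents_def list_scale_def proper_list_def)
  with assms show ?thesis by (auto simp: represents_def tl_of_scale mult.commute)
qed

lemma represents_add:
  assumes "represents s xs f" "represents s ys g"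
  shows "represents s (list_add xs ys) (f + g)"
proof -
  have "proper_list (list_add xs ys)"
    using assms unfolding list_add_def by (auto simp: represents_def proper_list_collect_terms)
  with assms show ?thesis by (auto simp: represents_def tl_of_add tl_scale_add)
qed

lemma represents_lookup:
  "represents s xs f \<Longrightarrow> Poly_Mapping.lookup f k = s * Poly_Mapping.lookup (tl_of xs) k"
  by (simp add: represents_def)

lemma represents_rescale: "represents s xs f \<Longrightarrow> represents (a * s) xs (a *\<^sub>C f)"
  by (auto simp: represents_def)

text \<open>Testing whether the difference collapses to the empty list makes the order of the terms
  immaterial. Only the soundness of the test is proved.\<close>

definition list_eq :: "list_tl \<Rightarrow> list_tl \<Rightarrow> bool" where
  "list_eq xs ys \<longleftrightarrow> list_add xs (list_scale (-1, 0, 0, 0) ys) = []"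

lemma tl_of_eqI:
  assumes "list_eq xs ys"
  shows "tl_of xs = tl_of ys"
proof -
  have "tl_of xs + (-1) *\<^sub>C tl_of ys = 0"
    using arg_cong[OF assms[unfolded list_eq_def], of tl_of]
    by (simp add: tl_of_add tl_of_scale) (simp add: coeff_val_def)
  moreover have "(-1) *\<^sub>C tl_of ys = - tl_of ys"
    by (rule poly_mapping_eqI) simp
  ultimately show ?thesis by simp
qed

section \<open>Projectors, trees and braids\<close>

definition list_id :: "nat \<Rightarrow> list_tl" where
  "list_id n = [((n, n, map (\<lambda>i. [(0, i), (1, i)]) [0..<n]), (1, 0, 0, 0))]"

definition list_cup :: "nat \<Rightarrow> list_tl" where
  "list_cup n = [((0, 2 * n, map (\<lambda>i. [(1, i), (1, 2 * n - 1 - i)]) [0..<n]), (1, 0, 0, 0))]"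

definition list_e :: list_tl where
  "list_e = list_comp (list_cup 1) (list_adjoint (list_cup 1))"

text \<open>The projector of charge 2 has the coefficient 1 / sqrt 3 = sqrt 3 / 3, so three times
  this projector has coefficients in Z[q].\<close>

definition jw_scale :: "nat \<Rightarrow> complex" where
  "jw_scale n = (if n = 2 then 1 / 3 else 1)"

text \<open>For \<open>n = 2\<close> this is 3 id - sqrt 3 e, with \<open>(0, 2, 0, -1)\<close> for
  - sqrt 3; the factors \<open>p\<close> are kept so as to follow the recursion of
  \<open>jones_wenzl\<close>. The value for \<open>n > 2\<close> is a placeholder.\<close>

definition list_jw :: "nat \<Rightarrow> list_tl" where
  "list_jw n =
     (if n = 2 then
        let p = list_tensor (list_id 1) (list_id 1)
        in list_add (list_scale (3, 0, 0, 0) p)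
             (list_scale (0, 2, 0, -1)
               (list_comp (list_comp p (list_tensor (list_id 0) list_e)) p))
      else list_id n)"

definition list_vertex :: "nat \<Rightarrow> nat \<Rightarrow> nat \<Rightarrow> list_tl" where
  "list_vertex a b c =
     list_comp (list_comp (list_tensor (list_jw a) (list_jw b))
       (list_tensor (list_tensor (list_id ((a + c - b) div 2)) (list_cup ((a + b - c) div 2)))
         (list_id ((b + c - a) div 2)))) (list_jw c)"

definition list_tree :: "nat \<Rightarrow> nat \<Rightarrow> nat \<Rightarrow> nat \<Rightarrow> nat \<Rightarrow> list_tl" where
  "list_tree a1 a2 a3 a4 c =
     list_comp (list_tensor (list_vertex a1 a2 c) (list_vertex a3 a4 c)) (list_vertex c c 0)"

text \<open>The crossing divided by A^-1, so that only powers of q = A^2 remain.\<close>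

definition list_crossing :: list_tl where
  "list_crossing = list_add (list_scale (0, 1, 0, 0) (list_id 2)) list_e"

fun list_braid_one :: "nat \<Rightarrow> list_tl" where
  "list_braid_one 0 = list_id 1"
| "list_braid_one (Suc n) =
     list_comp (list_tensor (list_id n) list_crossing) (list_tensor (list_braid_one n) (list_id 1))"

fun list_braid :: "nat \<Rightarrow> nat \<Rightarrow> list_tl" where
  "list_braid 0 n = list_id n"
| "list_braid (Suc m) n =
     list_comp (list_tensor (list_braid m n) (list_id 1)) (list_tensor (list_id m) (list_braid_one n))"

definition list_full_twist_23 :: "nat \<Rightarrow> nat \<Rightarrow> nat \<Rightarrow> nat \<Rightarrow> list_tl" where
  "list_full_twist_23 a1 a2 a3 a4 =
     list_tensor (list_tensor (list_id a1) (list_comp (list_braid a3 a2) (list_braid a2 a3)))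
       (list_id a4)"

section \<open>Correctness of the list versions of projectors, trees and braids\<close>

lemma represents_id: "represents 1 (list_id n) (tl_id n)"
proof -
  have "({{(0, i), (1, i)} | i. i < n} :: point set set) = (\<lambda>i. set [(0, i), (1, i)]) ` {..<n}"
    by auto
  then show ?thesis
    by (simp add: represents_def list_id_def tl_id_def diagram_of_def coeff_val_one
        proper_def image_image lessThan_atLeast0 image_iff)
qed

lemma represents_cup: "represents 1 (list_cup n) (tl_cup n)"
proof -
  have "({{(1, i), (1, 2 * n - 1 - i)} | i. i < n} :: point set set) =
      (\<lambda>i. set [(1, i), (1, 2 * n - 1 - i)]) ` {..<n}"
    by auto
  then show ?thesis
    by (simp add: represents_def list_cup_def tl_cup_def diagram_of_def coeff_val_one
        proper_def image_image lessThan_atLeast0 image_iff)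
qed

lemma represents_e: "represents 1 list_e tl_e"
  using represents_comp[OF represents_cup represents_adjoint[OF represents_cup]]
  by (simp add: tl_e_def list_e_def)

lemma represents_jw:
  assumes "n \<le> 2"
  shows "represents (jw_scale n) (list_jw n) (jones_wenzl n)"
proof -
  consider "n = 0" | "n = Suc 0" | "n = Suc (Suc 0)" using assms by linarith
  then show ?thesis
  proof cases
    case 3
    define p where "p = tl_id 1 \<otimes> tl_id 1"
    define x where "x = p \<odot> (tl_id 0 \<otimes> tl_e) \<odot> p"
    let ?p = "list_tensor (list_id 1) (list_id 1)"
    have p: "represents 1 ?p p"
      using represents_tensor[OF represents_id represents_id] by (simp add: p_def)
    have x: "represents 1 (list_comp (list_comp ?p (list_tensor (list_id 0) list_e)) ?p) x"
      using represents_comp[OF represents_comp[OF p represents_tensor[OF represents_id represents_e]] p]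
      by (simp add: x_def)
    have "jones_wenzl n = p - (1 / loop_value) *\<^sub>C x"
      by (simp add: 3 p_def x_def Let_def)
    also have "\<dots> = (1 / 3) *\<^sub>C (coeff_val (3, 0, 0, 0) *\<^sub>C p + coeff_val (0, 2, 0, -1) *\<^sub>C x)"
    proof (rule poly_mapping_eqI)
      have 1: "coeff_val (0, 2, 0, -1) = - loop_value"
        by (simp add: coeff_val_def loop_value_eq)
      have 2: "loop_value * loop_value = 3"
        by (simp add: loop_value_sqrt flip: of_real_mult)
      then have "loop_value \<noteq> 0" by auto
      with 2 have 3: "1 / loop_value = loop_value / 3" by (simp add: field_simps)
      show "Poly_Mapping.lookup (p - (1 / loop_value) *\<^sub>C x) k =
          Poly_Mapping.lookup
            ((1 / 3) *\<^sub>C (coeff_val (3, 0, 0, 0) *\<^sub>C p + coeff_val (0, 2, 0, -1) *\<^sub>C x)) k" for k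
        unfolding 1 3 by (simp add: lookup_minus lookup_add) (simp add: coeff_val_def field_simps)
    qed
    finally show ?thesis
      using represents_rescale[OF represents_add[OF represents_scale[OF p, of "(3, 0, 0, 0)"]
            represents_scale[OF x, of "(0, 2, 0, -1)"]], of "1 / 3"]
      by (simp add: 3 list_jw_def jw_scale_def Let_def numeral_2_eq_2)
  qed (use represents_id in \<open>simp_all add: list_jw_def jw_scale_def\<close>)
qed

lemma represents_vertex:
  assumes "a \<le> 2" "b \<le> 2" "c \<le> 2"
  shows "represents (jw_scale a * jw_scale b * jw_scale c) (list_vertex a b c) (vertex a b c)"
  using represents_comp[OF represents_comp[OF
      represents_tensor[OF represents_jw[OF assms(1)] represents_jw[OF assms(2)]]
      represents_tensor[OF represents_tensor[OF represents_id represents_cup] represents_id]]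
      represents_jw[OF assms(3)]]
  by (simp add: vertex_def list_vertex_def)

text \<open>The projector of charge \<open>c\<close> occurs four times: once in each vertex with two
  anyons, and twice in the vertex that joins the two branches to charge 0.\<close>

lemma represents_tree:
  assumes "a1 \<le> 2" "a2 \<le> 2" "a3 \<le> 2" "a4 \<le> 2" "c \<le> 2"
  shows "represents (jw_scale a1 * jw_scale a2 * jw_scale a3 * jw_scale a4 * jw_scale c ^ 4)
    (list_tree a1 a2 a3 a4 c) (fusion_tree a1 a2 a3 a4 c)"
proof -
  have "jw_scale 0 = 1" by (simp add: jw_scale_def)
  with represents_comp[OF represents_tensor[OF represents_vertex[OF assms(1,2,5)]
      represents_vertex[OF assms(3,4,5)]] represents_vertex[OF assms(5,5), of 0]]
  show ?thesis by (simp add: fusion_tree_def list_tree_def mult_ac eval_nat_numeral)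
qed

lemma represents_crossing: "represents (inverse kauffman_A) list_crossing crossing"
proof -
  have "crossing = inverse kauffman_A *\<^sub>C (coeff_val (0, 1, 0, 0) *\<^sub>C tl_id 2 + tl_e)"
    using kauffman_A_nonzero
    by (simp add: crossing_def tl_scale_add coeff_val_def kauffman_q_def power2_eq_square flip: mult.assoc)
  then show ?thesis
    using represents_rescale[OF represents_add[OF represents_scale[OF represents_id] represents_e],
        of "inverse kauffman_A" "(0, 1, 0, 0)" 2]
    by (simp add: list_crossing_def)
qed

lemma represents_braid_one:
  "represents (inverse kauffman_A ^ n) (list_braid_one n) (braid_one n)"
proof (induction n)
  case 0
  then show ?case using represents_id[of 1] by simp
next
  case (Suc n)
  from represents_comp[OF represents_tensor[OF represents_id represents_crossing]
      represents_tensor[OF Suc represents_id[of 1]], of n]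
  show ?case by simp
qed

lemma represents_braid:
  "represents (inverse kauffman_A ^ (m * n)) (list_braid m n) (braid m n)"
proof (induction m)
  case 0
  then show ?case using represents_id[of n] by simp
next
  case (Suc m)
  from represents_comp[OF represents_tensor[OF Suc represents_id[of 1]]
      represents_tensor[OF represents_id[of m] represents_braid_one[of n]]]
  show ?case by (simp add: power_add mult.commute)
qed

lemma represents_full_twist_23:
  "represents (inverse kauffman_A ^ (a3 * a2 + a2 * a3)) (list_full_twist_23 a1 a2 a3 a4)
    (full_twist_23 a1 a2 a3 a4)"
  using represents_tensor[OF represents_tensor[OF represents_id[of a1]
      represents_comp[OF represents_braid[of a3 a2] represents_braid[of a2 a3]]] represents_id[of a4]]
  by (simp add: full_twist_23_def list_full_twist_23_def flip: power_add)

section \<open>Planar matchings\<close>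

text \<open>The first point is paired with each of the others in turn, which gives all 15 perfect
  matchings of six points; planarity is imposed afterwards by a filter.\<close>

function matchings :: "'a list \<Rightarrow> 'a list list list" where
  "matchings [] = [[]]"
| "matchings (x # xs) =
     concat (map (\<lambda>y. map ((#) [x, y]) (matchings (remove1 y xs))) xs)"
  by pat_completeness auto
termination by (relation "measure length") (auto simp: length_remove1 less_Suc_eq_le)

text \<open>The block of the first point is a pair {x, y}; without it the other blocks partition the
  remaining points, to which the induction hypothesis applies.\<close>

lemma partition_into_pairs_in_matchings:
  assumes "distinct xs" "partition_on (set xs) E" "\<forall>B\<in>E. card B = 2"
  shows "\<exists>M\<in>set (matchings xs). E = set ` set M"
  using assms
proof (induction xs arbitrary: E rule: matchings.induct)
  case 1
  then show ?case by (simp add: partition_on_empty)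
next
  case (2 x xs)
  have U: "\<Union>E = set (x # xs)"
    using 2(3) by (simp add: partition_on_def)
  then obtain B where B: "B \<in> E" "x \<in> B" by (metis UnionE list.set_intros(1))
  then have "card (B - {x}) = 1" using 2(4) by simp
  then obtain y where "B - {x} = {y}" by (rule card_1_singletonE)
  with B(2) have y: "B = {x, y}" "y \<noteq> x" by auto
  then have y_in: "y \<in> set xs" using U B by auto
  have "B \<inter> C = {}" if "C \<in> E - {B}" for C
    using partition_onD2[OF 2(3)] B(1) that by (auto dest: disjointD)
  then have "disjnt B (\<Union>(E - {B}))" unfolding disjnt_def by blast
  moreover have "insert B (E - {B}) = E" using B(1) by blast
  ultimately have "partition_on (set (x # xs) - B) (E - {B})"
    using 2(3) by (metis partition_on_insert)
  also have "set (x # xs) - B = set (remove1 y xs)"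
    using 2(2) y by (auto simp: set_remove1_eq)
  finally have "partition_on (set (remove1 y xs)) (E - {B})" .
  moreover have "distinct (remove1 y xs)" using 2(2) by simp
  ultimately obtain M where M: "M \<in> set (matchings (remove1 y xs))" "E - {B} = set ` set M"
    using 2(1)[OF y_in, of "E - {B}"] 2(4) by auto
  have "[x, y] # M \<in> set (matchings (x # xs))" using M(1) y_in by auto
  moreover have "E = set ` set ([x, y] # M)"
    using M(2) B(1) y(1) by auto
  ultimately show ?case by blast
qed

lemma matchings_partition_on:
  assumes "distinct xs" "M \<in> set (matchings xs)"
  shows "partition_on (set xs) (set ` set M) \<and> (\<forall>B\<in>set ` set M. card B = 2)"
  using assms
proof (induction xs arbitrary: M rule: matchings.induct)
  case 1
  then show ?case by (simp add: partition_on_empty)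
next
  case (2 x xs)
  then obtain y N where y: "y \<in> set xs" "N \<in> set (matchings (remove1 y xs))" "M = [x, y] # N"
    by auto
  have IH: "partition_on (set (remove1 y xs)) (set ` set N)" "\<forall>B\<in>set ` set N. card B = 2"
    using 2(1)[OF y(1) _ y(2)] 2(2) by simp_all
  have xy: "x \<noteq> y" "x \<notin> set xs" "set (remove1 y xs) = set xs - {y}"
    using 2(2) y(1) by (auto simp: set_remove1_eq)
  have "partition_on (set (x # xs)) (insert {x, y} (set ` set N))"
    using IH(1) xy y(1) unfolding partition_on_def
    by (intro conjI) (auto simp: disjoint_def)
  then show ?case using IH(2) xy y(3) by simp
qed

text \<open>The quantifiers are bounded by the end points of the listed arcs, which makes the
  condition executable; both orders of the end points are tried, since \<open>noncrossing\<close>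
  speaks of unordered pairs.\<close>

definition list_noncrossing :: "nat \<Rightarrow> nat \<Rightarrow> point list list \<Rightarrow> bool" where
  "list_noncrossing m n M \<longleftrightarrow>
     (\<forall>B\<in>set M. \<forall>B'\<in>set M. \<forall>x\<in>set B. \<forall>y\<in>set B. \<forall>x'\<in>set B'. \<forall>y'\<in>set B'.
        set B = {x, y} \<longrightarrow> set B' = {x', y'} \<longrightarrow>
        \<not> (circ_pos m n x < circ_pos m n x' \<and> circ_pos m n x' < circ_pos m n y \<and>
           circ_pos m n y < circ_pos m n y'))"

lemma noncrossing_list: "noncrossing m n (set ` set M) \<longleftrightarrow> list_noncrossing m n M"
proof
  assume "noncrossing m n (set ` set M)"
  then show "list_noncrossing m n M"
    unfolding noncrossing_def list_noncrossing_def by (metis image_eqI)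
next
  assume *: "list_noncrossing m n M"
  show "noncrossing m n (set ` set M)"
    unfolding noncrossing_def
  proof (intro notI, elim exE conjE)
    fix x y x' y'
    assume "{x, y} \<in> set ` set M" "{x', y'} \<in> set ` set M" and
      lt: "circ_pos m n x < circ_pos m n x'" "circ_pos m n x' < circ_pos m n y"
        "circ_pos m n y < circ_pos m n y'"
    then obtain B B' where B: "B \<in> set M" "B' \<in> set M" "set B = {x, y}" "set B' = {x', y'}"
      by (metis imageE)
    moreover have "x \<in> set B" "y \<in> set B" "x' \<in> set B'" "y' \<in> set B'" using B by simp_all
    ultimately show False using * lt unfolding list_noncrossing_def by blast
  qed
qed

text \<open>Their number is the Catalan number 5. The points 0, 1 and the points 2, 3 belong to the
  two anyons of charge 2, the points 4 and 5 to those of charge 1.\<close>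

definition cups6 :: "point list list list" where
  "cups6 =
    [[[(1, 0), (1, 1)], [(1, 2), (1, 3)], [(1, 4), (1, 5)]],
     [[(1, 0), (1, 1)], [(1, 2), (1, 5)], [(1, 3), (1, 4)]],
     [[(1, 0), (1, 3)], [(1, 1), (1, 2)], [(1, 4), (1, 5)]],
     [[(1, 0), (1, 5)], [(1, 1), (1, 2)], [(1, 3), (1, 4)]],
     [[(1, 0), (1, 5)], [(1, 1), (1, 4)], [(1, 2), (1, 3)]]]"

lemma noncrossing_matchings_6:
  "filter (list_noncrossing 0 6) (matchings (map (Pair 1) [0..<6])) = cups6"
  by code_simp

lemma planar_diagrams_0_6: "planar_diagrams 0 6 = (\<lambda>L. diagram_of (0, 6, L)) ` set cups6"
proof (intro set_eqI iffI)
  have pts: "boundary_points 0 6 = set (map (Pair 1) [0..<6])"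
    by (auto simp: boundary_points_def)
  {
    fix D assume "D \<in> planar_diagrams 0 6"
    then obtain E where E: "D = (0, 6, E)" "partition_on (boundary_points 0 6) E"
      "\<forall>B\<in>E. card B = 2" "noncrossing 0 6 E"
      by (auto simp: planar_diagrams_def)
    have "\<exists>M\<in>set (matchings (map (Pair 1) [0..<6])). E = set ` set M"
      using E(2,3) unfolding pts
      by (intro partition_into_pairs_in_matchings) (simp_all add: distinct_map inj_on_def)
    then obtain M where M: "M \<in> set (matchings (map (Pair 1) [0..<6]))" "E = set ` set M" by blast
    then have "M \<in> set cups6"
      using E(4) unfolding noncrossing_matchings_6[symmetric] by (simp add: noncrossing_list)
    then show "D \<in> (\<lambda>L. diagram_of (0, 6, L)) ` set cups6"
      using E(1) M(2) by (auto simp: diagram_of_def)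
  next
    fix D assume "D \<in> (\<lambda>L. diagram_of (0, 6, L)) ` set cups6"
    then obtain M where M: "D = (0, 6, set ` set M)" "M \<in> set cups6"
      by (auto simp: diagram_of_def)
    have M': "M \<in> set (matchings (map (Pair 1) [0..<6]))" "list_noncrossing 0 6 M"
      using M(2) unfolding noncrossing_matchings_6[symmetric] by simp_all
    then have "noncrossing 0 6 (set ` set M)" by (simp add: noncrossing_list)
    moreover have "partition_on (boundary_points 0 6) (set ` set M) \<and>
        (\<forall>B\<in>set ` set M. card B = 2)"
      unfolding pts using M'(1)
      by (intro matchings_partition_on) (simp_all add: distinct_map inj_on_def)
    ultimately show "D \<in> planar_diagrams 0 6"
      using M(1) by (auto simp: planar_diagrams_def)
  }
qed

section \<open>Anyons of charges 2, 2, 1, 1\<close>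

definition tree0 :: tl where "tree0 = fusion_tree 2 2 1 1 0"

definition tree2 :: tl where "tree2 = fusion_tree 2 2 1 1 2"

definition projector :: tl where
  "projector = jones_wenzl 2 \<otimes> jones_wenzl 2 \<otimes> jones_wenzl 1 \<otimes> jones_wenzl 1"

definition list_projector :: list_tl where
  "list_projector =
     list_tensor (list_tensor (list_tensor (list_jw 2) (list_jw 2)) (list_jw 1)) (list_jw 1)"

definition cups :: "nat \<Rightarrow> tl" where
  "cups i = Poly_Mapping.single (diagram_of (0, 6, cups6 ! i)) 1"

definition list_cups :: "nat \<Rightarrow> list_tl" where
  "list_cups i = [((0, 6, cups6 ! i), (1, 0, 0, 0))]"

lemma represents_tree0: "represents (1 / 9) (list_tree 2 2 1 1 0) tree0"
  using represents_tree[of 2 2 1 1 0] by (simp add: tree0_def jw_scale_def)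

lemma represents_tree2: "represents (1 / 729) (list_tree 2 2 1 1 2) tree2"
  using represents_tree[of 2 2 1 1 2] by (simp add: tree2_def jw_scale_def power4_eq_xxxx)

lemma represents_projector: "represents (1 / 9) list_projector projector"
  using represents_tensor[OF represents_tensor[OF represents_tensor[OF represents_jw[of 2]
    represents_jw[of 2]] represents_jw[of 1]] represents_jw[of 1]]
  by (simp add: jw_scale_def list_projector_def projector_def)

lemma represents_cups:
  assumes "i < 5"
  shows "represents 1 (list_cups i) (cups i)"
proof -
  have "\<forall>L\<in>set cups6. [] \<notin> set L" by (simp add: cups6_def)
  moreover have "cups6 ! i \<in> set cups6" using assms by (intro nth_mem) (simp add: cups6_def)
  ultimately show ?thesis
    by (auto simp: represents_def list_cups_def cups_def proper_def coeff_val_one)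
qed

text \<open>The factor \<open>k\<close> need not lie in Z[q], so the proportionality is checked in
  the cross-multiplied form a xs = b ys with integral \<open>a\<close> and \<open>b\<close>; the
  fourth assumption relates them to \<open>k\<close> and the prefactors.\<close>

lemma represents_eq:
  assumes "represents s xs f" "represents t ys g" "list_eq (list_scale a xs) (list_scale b ys)"
    and "k * t * coeff_val a = s * coeff_val b" "coeff_val a \<noteq> 0"
  shows "f = k *\<^sub>C g"
proof -
  have f: "f = s *\<^sub>C tl_of xs" and g: "g = t *\<^sub>C tl_of ys"
    using assms(1,2) by (simp_all add: represents_def)
  have "coeff_val a *\<^sub>C tl_of xs = coeff_val b *\<^sub>C tl_of ys"
    using tl_of_eqI[OF assms(3)] by (simp add: tl_of_scale)
  then have "(s / coeff_val a) *\<^sub>C coeff_val a *\<^sub>C tl_of xs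
      = (s / coeff_val a) *\<^sub>C coeff_val b *\<^sub>C tl_of ys" by simp
  moreover have "s / coeff_val a * coeff_val b = k * t"
    using assms(4,5) by (simp add: field_simps)
  ultimately show ?thesis using assms(5) by (simp add: f g)
qed

text \<open>The twist of charges 2 and 1 has four crossings, whence A^-4; the factor 2 q^3 - q is
  what the evaluation of diagrams leaves.\<close>

definition twist_coeff :: complex where
  "twist_coeff = inverse kauffman_A ^ 4 * coeff_val (0, -1, 0, 2)"

text \<open>The value that unitarity demands: sqrt 3 is the ratio of the lengths of
  \<open>tree0\<close> and \<open>tree2\<close>, whose squares are 2 sqrt 3 and 2 / sqrt 3.\<close>

lemma norm_twist_coeff: "cmod twist_coeff = sqrt 3"
proof -
  have "coeff_val (0, -1, 0, 2) = Complex (sqrt 3 / 2) (3 / 2)"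
    unfolding coeff_val_def kauffman_q_eq
    by (simp add: complex_eq_iff power3_eq_cube field_simps kauffman_q_sqrt3)
  then have "cmod (coeff_val (0, -1, 0, 2)) = sqrt 3"
    by (simp add: cmod_def power_divide)
  then show ?thesis
    by (simp add: twist_coeff_def norm_mult norm_power norm_inverse norm_kauffman_A)
qed

lemma twist_tree0: "full_twist_23 2 2 1 1 \<odot> tree0 = twist_coeff *\<^sub>C tree2"
proof -
  \<comment> \<open>The factor 81 = 729 / 9 balances the prefactors 1/9 of \<open>tree0\<close> and
    1/729 of \<open>tree2\<close>.\<close>
  have "list_eq (list_scale (81, 0, 0, 0)
        (list_comp (list_full_twist_23 2 2 1 1) (list_tree 2 2 1 1 0)))
      (list_scale (0, -1, 0, 2) (list_tree 2 2 1 1 2))"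
    by code_simp
  from represents_eq[OF represents_comp[OF represents_full_twist_23 represents_tree0]
      represents_tree2 this, of twist_coeff]
  show ?thesis by (simp add: twist_coeff_def) (simp add: coeff_val_def)
qed

lemma twist_tree2: "full_twist_23 2 2 1 1 \<odot> tree2 = (twist_coeff / 3) *\<^sub>C tree0"
proof -
  \<comment> \<open>The right-hand factor is 27 (2 q^3 - q), where 27 = 81 / 3 combines the quotient
    of the prefactors with the third in the claimed coefficient.\<close>
  have "list_eq (list_scale (1, 0, 0, 0)
        (list_comp (list_full_twist_23 2 2 1 1) (list_tree 2 2 1 1 2)))
      (list_scale (0, -27, 0, 54) (list_tree 2 2 1 1 0))"
    by code_simp
  from represents_eq[OF represents_comp[OF represents_full_twist_23 represents_tree2]
      represents_tree0 this, of "twist_coeff / 3"]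
  show ?thesis by (simp add: twist_coeff_def) (simp add: coeff_val_def algebra_simps)
qed

text \<open>A cup joining two strands of one projector of charge 2 is annihilated, which disposes of
  the entries 0, 1 and 4. Entry 2 is the skeleton of \<open>tree0\<close>. Entry 3 is that of
  \<open>tree2\<close> without the projector on the inner line of charge 2; expanding this projector
  as id - (1 / sqrt 3) e adds a multiple of entry 2.\<close>

lemma project_cups:
  "projector \<odot> cups 0 = 0"
  "projector \<odot> cups 1 = 0"
  "projector \<odot> cups 2 = tree0"
  "projector \<odot> cups 3 = tree2 + (1 / of_real (sqrt 3)) *\<^sub>C tree0"
  "projector \<odot> cups 4 = 0"
proof -
  note cups = represents_comp[OF represents_projector represents_cups]
  \<comment> \<open>The fourth identity is the formula for entry 3 multiplied by 729, with 81 / sqrt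
    3 = 27 sqrt 3 written as 27 (q^3 - 2 q).\<close>
  have eqs: "list_eq (list_comp list_projector (list_cups 0)) []"
    "list_eq (list_comp list_projector (list_cups 1)) []"
    "list_eq (list_comp list_projector (list_cups 2)) (list_tree 2 2 1 1 0)"
    "list_eq (list_scale (81, 0, 0, 0) (list_comp list_projector (list_cups 3)))
      (list_add (list_tree 2 2 1 1 2) (list_scale (0, -54, 0, 27) (list_tree 2 2 1 1 0)))"
    "list_eq (list_comp list_projector (list_cups 4)) []"
    by code_simp+
  show "projector \<odot> cups 0 = 0" "projector \<odot> cups 1 = 0" "projector \<odot> cups 2 = tree0"
    "projector \<odot> cups 4 = 0"
    using cups[of 0] cups[of 1] cups[of 2] cups[of 4] represents_tree0 eqs(1,2,3,5)[THEN tl_of_eqI]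
    by (simp_all add: represents_def)
  show "projector \<odot> cups 3 = tree2 + (1 / of_real (sqrt 3)) *\<^sub>C tree0"
  proof (rule poly_mapping_eqI)
    fix k
    let ?c = "Poly_Mapping.lookup (tl_of (list_comp list_projector (list_cups 3))) k"
    let ?t0 = "Poly_Mapping.lookup (tl_of (list_tree 2 2 1 1 0)) k"
    let ?t2 = "Poly_Mapping.lookup (tl_of (list_tree 2 2 1 1 2)) k"
    have "coeff_val (81, 0, 0, 0) * ?c = ?t2 + coeff_val (0, -54, 0, 27) * ?t0"
      using arg_cong[OF tl_of_eqI[OF eqs(4)], of "\<lambda>f. Poly_Mapping.lookup f k"]
      by (simp add: tl_of_scale tl_of_add lookup_add)
    moreover have "coeff_val (81, 0, 0, 0) = 81" by (simp add: coeff_val_def)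
    moreover define r where "r = complex_of_real (sqrt 3)"
    moreover have "coeff_val (0, -54, 0, 27) = 27 * r"
      unfolding r_def by (simp add: coeff_val_def loop_value_eq flip: loop_value_sqrt)
    ultimately have c: "?c = (?t2 + 27 * r * ?t0) / 81" by (simp add: field_simps)
    have r: "1 / r = r / 3"
      unfolding r_def by (simp add: field_simps flip: of_real_mult)
    have trees: "Poly_Mapping.lookup (projector \<odot> cups 3) k = ?c / 9"
      "Poly_Mapping.lookup tree0 k = ?t0 / 9" "Poly_Mapping.lookup tree2 k = ?t2 / 729"
      using represents_lookup[OF cups[of 3]] represents_lookup[OF represents_tree0]
        represents_lookup[OF represents_tree2] by simp_all
    show "Poly_Mapping.lookup (projector \<odot> cups 3) k =
        Poly_Mapping.lookup (tree2 + (1 / of_real (sqrt 3)) *\<^sub>C tree0) k"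
      unfolding r_def[symmetric] r lookup_add lookup_tl_scale trees c by (simp add: field_simps)
  qed
qed

text \<open>These are closed networks. \<open>tree0\<close> closes up to loops of charges 2 and 1,
  of values 2 and sqrt 3; \<open>tree2\<close> gives theta(2,2,2) theta(1,1,2) / 2, where
  theta(1,1,2) = 2 and theta(2,2,2) = 2 / sqrt 3. The mixed products vanish because an inner
  projector of charge 2 is capped off.\<close>

lemma tl_inner_tree:
  "tl_inner tree0 tree0 = of_real (2 * sqrt 3)" "tl_inner tree0 tree2 = 0"
  "tl_inner tree2 tree0 = 0" "tl_inner tree2 tree2 = of_real (2 / sqrt 3)"
proof -
  let ?t0 = "list_tree 2 2 1 1 0" and ?t2 = "list_tree 2 2 1 1 2"
  \<comment> \<open>The entries are 162 sqrt 3 and 354294 sqrt 3; the squared prefactors 1/81 and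
    1/531441 turn them into 2 sqrt 3 and (2/3) sqrt 3.\<close>
  have eqs: "list_eq (list_comp (list_adjoint ?t0) ?t0) [((0, 0, []), (0, -324, 0, 162))]"
    "list_eq (list_comp (list_adjoint ?t0) ?t2) []"
    "list_eq (list_comp (list_adjoint ?t2) ?t0) []"
    "list_eq (list_comp (list_adjoint ?t2) ?t2) [((0, 0, []), (0, -708588, 0, 354294))]"
    by code_simp+
  note inner = represents_comp[OF represents_adjoint]
  show "tl_inner tree0 tree2 = 0" "tl_inner tree2 tree0 = 0"
    using inner[OF represents_tree0 represents_tree2] inner[OF represents_tree2 represents_tree0]
      eqs(2,3)[THEN tl_of_eqI]
    by (simp_all add: represents_def tl_inner_def)
  have "diagram_of (0, 0, []) = (0, 0, {})" by (simp add: diagram_of_def)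
  moreover have "coeff_val (0, -324, 0, 162) = 162 * of_real (sqrt 3)"
    "coeff_val (0, -708588, 0, 354294) = 354294 * of_real (sqrt 3)"
    by (simp_all add: coeff_val_def loop_value_eq flip: loop_value_sqrt)
  moreover have "complex_of_real (sqrt 3) / 3 = 1 / of_real (sqrt 3)"
    by (simp add: field_simps flip: of_real_mult)
  ultimately show "tl_inner tree0 tree0 = of_real (2 * sqrt 3)"
    "tl_inner tree2 tree2 = of_real (2 / sqrt 3)"
    using inner[OF represents_tree0 represents_tree0] inner[OF represents_tree2 represents_tree2]
      eqs(1,4)[THEN tl_of_eqI]
    by (simp_all add: represents_def tl_inner_def field_simps)
qed

section \<open>Normalized states and the span of the state space\<close>

lemma tl_inner_scale: "tl_inner (a *\<^sub>C x) (b *\<^sub>C y) = cnj a * b * tl_inner x y"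
  by (simp add: tl_inner_def tl_adjoint_scale tl_comp_scale_left tl_comp_scale_right)

lemma fusion_state_tree:
  "fusion_state 2 2 1 1 0 = of_real (1 / sqrt (2 * sqrt 3)) *\<^sub>C tree0"
  "fusion_state 2 2 1 1 2 = of_real (1 / sqrt (2 / sqrt 3)) *\<^sub>C tree2"
  unfolding fusion_state_def Let_def tree0_def[symmetric] tree2_def[symmetric] tl_inner_tree
  by simp_all

lemma fusion_labels_2211: "fusion_labels 2 2 1 1 = {0, 2}"
proof -
  have "c = 0 \<or> c = 2" if "admissible 1 1 c" for c
  proof -
    have "even c" "c \<le> 2" using that by (simp_all add: admissible_def)
    then have "c \<noteq> 1" "c \<le> 2" by auto
    then show ?thesis by linarith
  qed
  moreover have "admissible 2 2 c" "admissible 1 1 c" "admissible c c 0" if "c = 0 \<or> c = 2" for c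
    using that by (elim disjE; simp add: admissible_def)+
  ultimately show ?thesis unfolding fusion_labels_def by blast
qed

lemma cups_in_tl_hom:
  assumes "i < 5"
  shows "a *\<^sub>C cups i \<in> tl_hom 0 6"
proof -
  have "cups6 ! i \<in> set cups6" using assms by (intro nth_mem) (simp add: cups6_def)
  then show ?thesis
    by (auto simp: tl_hom_def cups_def tl_scale_single planar_diagrams_0_6)
qed

lemma tl_hom_add: "f \<in> tl_hom m n \<Longrightarrow> g \<in> tl_hom m n \<Longrightarrow> f + g \<in> tl_hom m n"
  using Poly_Mapping.keys_add[of f g] by (auto simp: tl_hom_def)

text \<open>By linearity it suffices to project single diagrams, and the five entries of
  \<open>cups6\<close> exhaust the planar ones.\<close>

lemma project_span:
  assumes "y \<in> tl_hom 0 6"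
  shows "\<exists>a b. projector \<odot> y = a *\<^sub>C tree0 + b *\<^sub>C tree2"
proof -
  have add: "\<exists>a b. f + g = a *\<^sub>C tree0 + b *\<^sub>C tree2"
    if "\<exists>a b. f = a *\<^sub>C tree0 + b *\<^sub>C tree2" "\<exists>a b. g = a *\<^sub>C tree0 + b *\<^sub>C tree2" for f g
  proof -
    from that obtain a b a' b' where "f = a *\<^sub>C tree0 + b *\<^sub>C tree2" "g = a' *\<^sub>C tree0 + b' *\<^sub>C tree2"
      by blast
    then have "f + g = (a + a') *\<^sub>C tree0 + (b + b') *\<^sub>C tree2"
      by (intro poly_mapping_eqI) (simp add: lookup_add algebra_simps)
    then show ?thesis by blast
  qed
  have zero: "\<exists>a b. 0 = a *\<^sub>C tree0 + b *\<^sub>C tree2"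
    by (intro exI[of _ 0] poly_mapping_eqI) (simp add: lookup_add)
  have single: "\<exists>a b. projector \<odot> Poly_Mapping.single D c = a *\<^sub>C tree0 + b *\<^sub>C tree2"
    if D: "D \<in> planar_diagrams 0 6" for D c
  proof -
    obtain L where L: "L \<in> set cups6" "D = diagram_of (0, 6, L)"
      using D unfolding planar_diagrams_0_6 by blast
    have "length cups6 = 5" by (simp add: cups6_def)
    then obtain i where i: "i < 5" "L = cups6 ! i"
      using L(1) by (metis in_set_conv_nth)
    have "Poly_Mapping.single D c = c *\<^sub>C cups i"
      by (simp add: cups_def tl_scale_single L(2) i(2))
    then have eq: "projector \<odot> Poly_Mapping.single D c = c *\<^sub>C (projector \<odot> cups i)"
      by (simp only: tl_comp_scale_right)
    have "\<exists>a b. projector \<odot> cups i = a *\<^sub>C tree0 + b *\<^sub>C tree2"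
    proof -
      consider "i = 0 \<or> i = 1 \<or> i = 4" | "i = 2" | "i = 3" using i(1) by linarith
      then show ?thesis
      proof cases
        case 1
        then show ?thesis using project_cups zero by metis
      next
        case 2
        then have "projector \<odot> cups i = 1 *\<^sub>C tree0 + 0 *\<^sub>C tree2"
          by (simp only: project_cups) (rule poly_mapping_eqI, simp add: lookup_add)
        then show ?thesis by blast
      next
        case 3
        then have "projector \<odot> cups i = (1 / of_real (sqrt 3)) *\<^sub>C tree0 + 1 *\<^sub>C tree2"
          by (simp only: project_cups tl_scale_one add.commute)
        then show ?thesis by blast
      qed
    qed
    then obtain a b where "projector \<odot> cups i = a *\<^sub>C tree0 + b *\<^sub>C tree2" by blast
    then have "projector \<odot> Poly_Mapping.single D c = (c * a) *\<^sub>C tree0 + (c * b) *\<^sub>C tree2"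
      unfolding eq by (simp add: tl_scale_add)
    then show ?thesis by blast
  qed
  \<comment> \<open>The induction runs over finite sets \<open>S\<close> with the coefficients of
    \<open>y\<close> held fixed; the support of \<open>y\<close> is substituted at the end.\<close>
  have "\<exists>a b. projector \<odot> (\<Sum>D\<in>S. Poly_Mapping.single D (Poly_Mapping.lookup y D))
      = a *\<^sub>C tree0 + b *\<^sub>C tree2" if "finite S" "S \<subseteq> planar_diagrams 0 6" for S
    using that
  proof (induction S)
    case empty
    then show ?case using zero by simp
  next
    case (insert D S)
    then have "\<exists>a b. projector \<odot> (\<Sum>D\<in>S. Poly_Mapping.single D (Poly_Mapping.lookup y D))
        = a *\<^sub>C tree0 + b *\<^sub>C tree2" by simp
    moreover have "D \<in> planar_diagrams 0 6" using insert by simp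
    ultimately show ?case
      unfolding sum.insert[OF insert(1,2)] tl_comp_add_right by (intro add single)
  qed
  moreover have "(\<Sum>D\<in>Poly_Mapping.keys y. Poly_Mapping.single D (Poly_Mapping.lookup y D)) = y"
    by (rule poly_mapping_eqI) (simp add: lookup_sum lookup_single when_def in_keys_iff)
  ultimately show ?thesis
    using assms by (metis (no_types, lifting) finite_keys mem_Collect_eq tl_hom_def)
qed

lemma fusion_states_2211: "fusion_states_orthonormal_basis 2 2 1 1"
proof -
  let ?v = "fusion_state 2 2 1 1"
  let ?n0 = "complex_of_real (1 / sqrt (2 * sqrt 3))"
  let ?n2 = "complex_of_real (1 / sqrt (2 / sqrt 3))"
  have space: "state_space 2 2 1 1 = (\<lambda>x. projector \<odot> x) ` tl_hom 0 6"
    by (simp add: state_space_def projector_def)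
  have "?v 0 = projector \<odot> (?n0 *\<^sub>C cups 2)"
    by (simp only: fusion_state_tree tl_comp_scale_right project_cups)
  then have in0: "?v 0 \<in> state_space 2 2 1 1"
    unfolding space by (rule image_eqI) (simp add: cups_in_tl_hom)
  \<comment> \<open>The preimage solves the formula for the projection of \<open>cups 3\<close> for
    \<open>tree2\<close>: subtract 1 / sqrt 3 times \<open>cups 2\<close>, which projects to
    \<open>tree0\<close>.\<close>
  have "?v 2 = projector \<odot> (?n2 *\<^sub>C cups 3 + (- ?n2 / of_real (sqrt 3)) *\<^sub>C cups 2)"
    unfolding fusion_state_tree tl_comp_add_right tl_comp_scale_right project_cups
    by (rule poly_mapping_eqI) (simp add: lookup_add algebra_simps)
  moreover have "?n2 *\<^sub>C cups 3 + (- ?n2 / of_real (sqrt 3)) *\<^sub>C cups 2 \<in> tl_hom 0 6"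
    by (intro tl_hom_add cups_in_tl_hom) simp_all
  ultimately have in2: "?v 2 \<in> state_space 2 2 1 1"
    unfolding space by (rule image_eqI)
  have norm: "cnj (of_real (1 / sqrt a)) * of_real (1 / sqrt a) * of_real a = 1" if "a > 0" for a
  proof -
    have "1 / sqrt a * (1 / sqrt a) * a = 1" using that by (simp add: field_simps)
    then show ?thesis by (metis complex_cnj_complex_of_real of_real_1 of_real_mult)
  qed
  have "tl_inner (?v 0) (?v 0) = 1" "tl_inner (?v 2) (?v 2) = 1"
    unfolding fusion_state_tree tl_inner_scale tl_inner_tree by (rule norm, simp)+
  moreover have "tl_inner (?v 0) (?v 2) = 0" "tl_inner (?v 2) (?v 0) = 0"
    by (simp_all only: fusion_state_tree tl_inner_scale tl_inner_tree mult_zero_right)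
  ultimately have inner: "tl_inner (?v c) (?v c') = (if c = c' then 1 else 0)"
    if "c \<in> {0, 2}" "c' \<in> {0, 2}" for c c'
    using that by (auto simp del: One_nat_def)
  have span: "\<exists>k. state_eq 2 2 1 1 x (\<Sum>c\<in>{0, 2}. k c *\<^sub>C ?v c)" if x: "x \<in> state_space 2 2 1 1" for x
  proof -
    obtain a b where ab: "x = a *\<^sub>C tree0 + b *\<^sub>C tree2"
      using x project_span unfolding space by blast
    define k where "k c = (if c = 0 then a / ?n0 else b / ?n2)" for c :: nat
    have "(\<Sum>c\<in>{0, 2}. k c *\<^sub>C ?v c) = x"
      by (simp add: k_def fusion_state_tree ab del: One_nat_def)
    then show ?thesis by (intro exI[of _ k]) (simp add: state_eq_def tlj_eq_def)
  qed
  show ?thesis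
    unfolding fusion_states_orthonormal_basis_def fusion_labels_2211 Let_def
    using in0 in2 inner span by blast
qed

theorem mainTheorem3:
  shows "fusion_labels 2 2 1 1 = {0, 2}
    \<and> fusion_states_orthonormal_basis 2 2 1 1
    \<and> (\<exists>u :: complex. cmod u = 1 \<and>
          state_eq 2 2 1 1 (full_twist_23 2 2 1 1 \<odot> fusion_state 2 2 1 1 0)
                           (u *\<^sub>C fusion_state 2 2 1 1 2))
    \<and> (\<exists>w :: complex. cmod w = 1 \<and>
          state_eq 2 2 1 1 (full_twist_23 2 2 1 1 \<odot> fusion_state 2 2 1 1 2)
                           (w *\<^sub>C fusion_state 2 2 1 1 0))"
proof (intro conjI fusion_labels_2211 fusion_states_2211)
  \<comment> \<open>\<open>r\<close> is the length of \<open>tree2\<close>, and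
    \<open>sqrt 3 * r\<close> is that of \<open>tree0\<close>; after normalization both off-diagonal
    entries become \<open>twist_coeff / sqrt 3\<close>.\<close>
  define r where "r = sqrt (2 / sqrt 3)"
  have r: "r > 0" by (simp add: r_def)
  have "2 * sqrt 3 = 3 * (2 / sqrt 3)" by (simp add: field_simps)
  then have n0: "sqrt (2 * sqrt 3) = sqrt 3 * r"
    unfolding r_def by (simp only: real_sqrt_mult)
  show "\<exists>u. cmod u = 1 \<and>
      state_eq 2 2 1 1 (full_twist_23 2 2 1 1 \<odot> fusion_state 2 2 1 1 0)
        (u *\<^sub>C fusion_state 2 2 1 1 2)"
  proof (intro exI conjI)
    show "cmod (twist_coeff / sqrt 3) = 1" by (simp add: norm_divide norm_twist_coeff)
    show "state_eq 2 2 1 1 (full_twist_23 2 2 1 1 \<odot> fusion_state 2 2 1 1 0)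
        ((twist_coeff / sqrt 3) *\<^sub>C fusion_state 2 2 1 1 2)"
      using r unfolding fusion_state_tree n0 r_def[symmetric]
      by (simp add: state_eq_def tlj_eq_def tl_comp_scale_right twist_tree0 del: One_nat_def)
  qed
  show "\<exists>w. cmod w = 1 \<and>
      state_eq 2 2 1 1 (full_twist_23 2 2 1 1 \<odot> fusion_state 2 2 1 1 2)
        (w *\<^sub>C fusion_state 2 2 1 1 0)"
  proof (intro exI conjI)
    show "cmod (twist_coeff / sqrt 3) = 1" by (simp add: norm_divide norm_twist_coeff)
    \<comment> \<open>Of the divisor 3, one factor sqrt 3 goes into the phase and the other into the
      length of \<open>tree0\<close>.\<close>
    have "1 / r / 3 = 1 / sqrt 3 * (1 / (sqrt 3 * r))"
      using r by (simp add: field_simps)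
    then have "complex_of_real (1 / r) / 3 = 1 / of_real (sqrt 3) * of_real (1 / (sqrt 3 * r))"
      by (metis of_real_1 of_real_divide of_real_mult of_real_numeral)
    then have "complex_of_real (1 / r) / 3 * twist_coeff =
        1 / of_real (sqrt 3) * of_real (1 / (sqrt 3 * r)) * twist_coeff" by simp
    then have eq: "of_real (1 / r) * (twist_coeff / 3) =
        twist_coeff / of_real (sqrt 3) * of_real (1 / (sqrt 3 * r))"
      by (simp add: mult_ac)
    show "state_eq 2 2 1 1 (full_twist_23 2 2 1 1 \<odot> fusion_state 2 2 1 1 2)
        ((twist_coeff / of_real (sqrt 3)) *\<^sub>C fusion_state 2 2 1 1 0)"
      unfolding fusion_state_tree n0 r_def[symmetric] tl_comp_scale_right twist_tree2
        tl_scale_tl_scale eq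
      by (simp add: state_eq_def tlj_eq_def)
  qed
qed

end
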